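(* Suppose there exist positive integer constants $d,c,N_0$ and a family $\{U_n\}_{n\ge N_0}$ of $\mathrm{QAC}^0$ circuits such that for each $n\ge N_0$, $U_n$ has depth $d$, $n$ input qubits and $n^c$ ancilla qubits, and computes $\mathrm{PARITY}_n$ with worst-case error $\mathrm{negl}(n)$. Then there exists $D=O(cd)$ such that for every $K\ge1$ and infinitely many $n$, one can construct a $\mathrm{QAC}^0$ circuit of depth $KD$, with $n$ input qubits and $n^{1+2^{-K}}$ ancilla qubits, which computes $\mathrm{PARITY}_n$ with worst-case error $\mathrm{negl}(n)$.
   Context: A depth-$d$ $\mathrm{QAC}^0$ circuit on $m$ qubits is a unitary $U=L_dM_d\cdots L_1M_1L_0$ where each $L_i$ is a tensor product of single-qubit unitaries and each $M_i$ is a tensor product of multi-qubit CZ gates $I-2|1^s\rangle\langle1^s|$ on pairwise disjoint sets of qubits. Ancilla qubits are initialized to $|0\rangle$. On input $x$, the circuit is applied to $|x\rangle\otimes|0^a\rangle$ and the first qubit is measured in the computational basis; worst-case error $\epsilon$ means the output differs from $\mathrm{PARITY}_n(x)=\bigoplus_ix_i$ with probability at most $\epsilon$ for every $x$. $\mathrm{negl}(n)$ denotes a function smaller than $n^{-c'}$ for every $c'$ and all large $n$. *)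

theory Defs
  imports Complex_Main
begin

(* Computational basis states of an m-qubit register: bit strings r :: nat => bool
   with r i = False for every i >= m (qubit i holds bit r i). *)
definition basis :: "nat \<Rightarrow> (nat \<Rightarrow> bool) set" where
  "basis m = {r. \<forall>i\<ge>m. \<not> r i}"

(* A single-qubit gate, given by its matrix entries g a b = <a|g|b>. *)
type_synonym gate1 = "bool \<Rightarrow> bool \<Rightarrow> complex"

definition unitary1 :: "gate1 \<Rightarrow> bool" where
  "unitary1 g \<longleftrightarrow> (\<forall>a b. (\<Sum>c\<in>UNIV. g a c * cnj (g b c)) = (if a = b then 1 else 0))"

type_synonym state = "(nat \<Rightarrow> bool) \<Rightarrow> complex"

(* Layer L = tensor product of single-qubit unitaries gs 0, ..., gs (m-1). *)
definition apply_L :: "nat \<Rightarrow> (nat \<Rightarrow> gate1) \<Rightarrow> state \<Rightarrow> state" where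
  "apply_L m gs psi = (\<lambda>r. \<Sum>s\<in>basis m. (\<Prod>i<m. gs i (r i) (s i)) * psi s)"

(* Layer M = tensor product of multi-qubit CZ gates I - 2|1^s><1^s| on the sets in Ss. *)
definition apply_M :: "nat set set \<Rightarrow> state \<Rightarrow> state" where
  "apply_M Ss psi = (\<lambda>r. (\<Prod>S\<in>Ss. if (\<forall>i\<in>S. r i) then - 1 else 1) * psi r)"

definition cz_layer :: "nat \<Rightarrow> nat set set \<Rightarrow> bool" where
  "cz_layer m Ss \<longleftrightarrow> (\<forall>S\<in>Ss. S \<noteq> {} \<and> S \<subseteq> {..<m}) \<and>
     (\<forall>S\<in>Ss. \<forall>T\<in>Ss. S \<noteq> T \<longrightarrow> S \<inter> T = {})"

(* A circuit: L j i is the gate on qubit i in single-qubit layer L_j (j = 0..d),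
   M j is the set of CZ supports in layer M_j (j = 1..d). *)
type_synonym circuit = "(nat \<Rightarrow> nat \<Rightarrow> gate1) \<times> (nat \<Rightarrow> nat set set)"

definition qac0_circuit :: "nat \<Rightarrow> nat \<Rightarrow> circuit \<Rightarrow> bool" where
  "qac0_circuit m d C \<longleftrightarrow> (\<forall>j\<le>d. \<forall>i<m. unitary1 (fst C j i)) \<and>
     (\<forall>j\<in>{1..d}. cz_layer m (snd C j))"

fun run :: "nat \<Rightarrow> circuit \<Rightarrow> nat \<Rightarrow> state \<Rightarrow> state" where
  "run m C 0 psi = apply_L m (fst C 0) psi"
| "run m C (Suc k) psi = apply_L m (fst C (Suc k)) (apply_M (snd C (Suc k)) (run m C k psi))"

(* |x> \<otimes> |0^a>: inputs on qubits 0..n-1, ancillas on qubits n..n+a-1 *)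
definition input_state :: "nat \<Rightarrow> (nat \<Rightarrow> bool) \<Rightarrow> state" where
  "input_state n x = (\<lambda>r. if r = (\<lambda>i. i < n \<and> x i) then 1 else 0)"

definition prob_out :: "nat \<Rightarrow> state \<Rightarrow> bool \<Rightarrow> real" where
  "prob_out m psi b = (\<Sum>r\<in>basis m. if r 0 = b then (cmod (psi r))^2 else 0)"

definition parity :: "nat \<Rightarrow> (nat \<Rightarrow> bool) \<Rightarrow> bool" where
  "parity n x \<longleftrightarrow> odd (card {i. i < n \<and> x i})"

definition computes_parity :: "nat \<Rightarrow> nat \<Rightarrow> nat \<Rightarrow> circuit \<Rightarrow> real \<Rightarrow> bool" where
  "computes_parity n a d C eps \<longleftrightarrow> qac0_circuit (n + a) d C \<and>
     (\<forall>x. prob_out (n + a) (run (n + a) C d (input_state n x)) (\<not> parity n x) \<le> eps)"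

definition negligible :: "(nat \<Rightarrow> real) \<Rightarrow> bool" where
  "negligible f \<longleftrightarrow> (\<forall>c'::nat. eventually (\<lambda>n. f n < inverse (real n ^ c')) at_top)"

end

theory Submission
  imports Defs
begin

text \<open>Parity is computed by a tree: the bits are grouped into blocks, the assumed circuits compute
  the block parities in parallel, and their output qubits feed the next level. The garbage of a level
  need not be uncomputed, because projecting the output wires onto the correct block parities leaves a
  product state, and by a union bound this projection changes the state only negligibly.

  With \<open>n = t ^ E\<close> inputs, a level of fan-in \<open>t ^ e\<close> acting on \<open>t ^ (s + e)\<close> remaining bits costs
  \<open>t ^ (s + c * e)\<close> ancillas. Hence the fan-in can grow as the number of bits shrinks: every
  \<open>2 * c\<close> levels the exponent \<open>e\<close> can be doubled, so \<open>2 * c * K\<close> levels of depth \<open>d\<close> suffice when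
  the first exponent is about a fraction \<open>1 / (2 * c * 2 ^ K)\<close> of \<open>E\<close>.\<close>

section \<open>States on sets of wires\<close>

text \<open>Registers are arbitrary wire sets, since the wires of one block need not form an initial
  segment. Bits outside \<open>A\<close> are \<open>False\<close>, so strings on disjoint registers
  are joined by \<open>sup\<close>.\<close>

definition basis_on :: "nat set \<Rightarrow> (nat \<Rightarrow> bool) set" where
  "basis_on A = {r. \<forall>i. i \<notin> A \<longrightarrow> \<not> r i}"

definition apply_L_on :: "nat set \<Rightarrow> (nat \<Rightarrow> gate1) \<Rightarrow> state \<Rightarrow> state" where
  "apply_L_on A gs psi = (\<lambda>r. \<Sum>s\<in>basis_on A. (\<Prod>i\<in>A. gs i (r i) (s i)) * psi s)"

text \<open>CZ gates not lying inside \<open>A\<close> are dropped, so that one circuit can be run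
  on each part of a register separately.\<close>

fun run_on :: "nat set \<Rightarrow> circuit \<Rightarrow> nat \<Rightarrow> state \<Rightarrow> state" where
  "run_on A C 0 psi = apply_L_on A (fst C 0) psi"
| "run_on A C (Suc k) psi = apply_L_on A (fst C (Suc k))
     (apply_M {S \<in> snd C (Suc k). S \<subseteq> A} (run_on A C k psi))"

definition norm2_on :: "nat set \<Rightarrow> state \<Rightarrow> real" where
  "norm2_on A psi = (\<Sum>r\<in>basis_on A. (cmod (psi r))\<^sup>2)"

definition prob_on :: "nat set \<Rightarrow> nat \<Rightarrow> bool \<Rightarrow> state \<Rightarrow> real" where
  "prob_on A q v psi = (\<Sum>r\<in>basis_on A. if r q = v then (cmod (psi r))\<^sup>2 else 0)"

lemma basis_eq_basis_on: "basis m = basis_on {..<m}"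
  by (auto simp: basis_def basis_on_def)

lemma prob_out_eq_prob_on: "prob_out m psi b = prob_on {..<m} 0 b psi"
  by (simp add: prob_out_def prob_on_def basis_eq_basis_on)

lemma cz_layer_finite: "cz_layer m Ss \<Longrightarrow> finite Ss"
  unfolding cz_layer_def by (rule finite_subset[of _ "Pow {..<m}"]) auto

lemma run_eq_run_on:
  assumes "qac0_circuit m d C" "k \<le> d"
  shows "run m C k psi = run_on {..<m} C k psi"
  using assms(2)
proof (induction k)
  case 0
  show ?case by (simp add: apply_L_def apply_L_on_def basis_eq_basis_on)
next
  case (Suc k)
  have "{S \<in> snd C (Suc k). S \<subseteq> {..<m}} = snd C (Suc k)"
  proof -
    have "cz_layer m (snd C (Suc k))"
      using assms(1) Suc.prems by (simp add: qac0_circuit_def)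
    then show ?thesis by (auto simp: cz_layer_def)
  qed
  then show ?case
    using Suc by (simp add: apply_L_def apply_L_on_def basis_eq_basis_on)
qed

section \<open>Splitting registers\<close>

lemma sup_in_basis_on:
  "u \<in> basis_on A \<Longrightarrow> v \<in> basis_on B \<Longrightarrow> sup u v \<in> basis_on (A \<union> B)"
  by (auto simp: basis_on_def)

lemma restrict_in_basis_on: "(\<lambda>i. i \<in> A \<and> r i) \<in> basis_on A"
  by (auto simp: basis_on_def)

lemma sup_restrict:
  "r \<in> basis_on (A \<union> B) \<Longrightarrow> sup (\<lambda>i. i \<in> A \<and> r i) (\<lambda>i. i \<in> B \<and> r i) = r"
  by (fastforce simp: basis_on_def fun_eq_iff)

lemma sup_left:
  assumes "A \<inter> B = {}" "v \<in> basis_on B" "i \<in> A"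
  shows "sup u v i = (u i :: bool)"
  using assms by (auto simp: basis_on_def)

lemma sup_right:
  assumes "A \<inter> B = {}" "u \<in> basis_on A" "i \<in> B"
  shows "sup u v i = (v i :: bool)"
  using assms by (auto simp: basis_on_def)

text \<open>This bijection is the tensor decomposition of a register: restricting to
  \<open>A\<close> and to \<open>B\<close> inverts the gluing by \<open>sup\<close>.\<close>

lemma bij_betw_sup_basis_on:
  assumes "A \<inter> B = {}"
  shows "bij_betw (\<lambda>(u, v). sup u v) (basis_on A \<times> basis_on B) (basis_on (A \<union> B))"
proof (rule bij_betw_byWitness[where f' = "\<lambda>r. (\<lambda>i. i \<in> A \<and> r i, \<lambda>i. i \<in> B \<and> r i)"])
  show "\<forall>p\<in>basis_on A \<times> basis_on B.
      (\<lambda>r. (\<lambda>i. i \<in> A \<and> r i, \<lambda>i. i \<in> B \<and> r i)) (case p of (u, v) \<Rightarrow> sup u v) = p"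
    using assms by (fastforce simp: basis_on_def fun_eq_iff)
qed (use sup_restrict sup_in_basis_on restrict_in_basis_on in auto)

lemma sum_basis_on_Un:
  assumes "A \<inter> B = {}"
  shows "(\<Sum>r\<in>basis_on (A \<union> B). F r) = (\<Sum>u\<in>basis_on A. \<Sum>v\<in>basis_on B. F (sup u v))"
  by (subst sum.reindex_bij_betw[OF bij_betw_sup_basis_on[OF assms], symmetric])
     (simp add: sum.cartesian_product case_prod_unfold)

lemma basis_on_empty: "basis_on {} = {\<lambda>_. False}"
  by (auto simp: basis_on_def)

lemma basis_on_singleton: "basis_on {q} = (\<lambda>v i. i = q \<and> v) ` UNIV"
proof
  show "basis_on {q} \<subseteq> (\<lambda>v i. i = q \<and> v) ` UNIV"
  proof
    fix r assume "r \<in> basis_on {q}"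
    then have "r = (\<lambda>i. i = q \<and> r q)" by (auto simp: basis_on_def fun_eq_iff)
    then show "r \<in> (\<lambda>v i. i = q \<and> v) ` UNIV" by blast
  qed
qed (auto simp: basis_on_def)

lemma sum_basis_on_singleton:
  "(\<Sum>r\<in>basis_on {q}. F r) = (\<Sum>v\<in>UNIV. F (\<lambda>i. i = q \<and> v))"
proof -
  have "inj (\<lambda>v i. i = q \<and> v)" by (auto simp: inj_def fun_eq_iff)
  then show ?thesis by (simp add: basis_on_singleton sum.reindex)
qed

lemma finite_basis_on: "finite A \<Longrightarrow> finite (basis_on A)"
proof (induction A rule: finite_induct)
  case (insert q A)
  have "bij_betw (\<lambda>(u, v). sup u v) (basis_on {q} \<times> basis_on A) (basis_on ({q} \<union> A))"
    using insert.hyps by (intro bij_betw_sup_basis_on) auto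
  then show ?case
    using insert.IH bij_betw_finite by (fastforce simp: basis_on_singleton)
qed (simp add: basis_on_empty)

text \<open>Distributivity, one wire at a time. It reduces products and Gram matrices of tensor
  layers to sums over a single qubit.\<close>

lemma sum_basis_on_prod:
  fixes h :: "nat \<Rightarrow> bool \<Rightarrow> complex"
  assumes "finite A"
  shows "(\<Sum>r\<in>basis_on A. \<Prod>i\<in>A. h i (r i)) = (\<Prod>i\<in>A. \<Sum>v\<in>UNIV. h i v)"
  using assms
proof (induction A rule: finite_induct)
  case (insert q A)
  have "(\<Sum>r\<in>basis_on (insert q A). \<Prod>i\<in>insert q A. h i (r i))
      = (\<Sum>u\<in>basis_on {q}. \<Sum>w\<in>basis_on A. \<Prod>i\<in>insert q A. h i (sup u w i))"
    using sum_basis_on_Un[of "{q}" A "\<lambda>r. \<Prod>i\<in>insert q A. h i (r i)"] insert.hyps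
    by simp
  also have "\<dots> = (\<Sum>u\<in>basis_on {q}. \<Sum>w\<in>basis_on A. h q (u q) * (\<Prod>i\<in>A. h i (w i)))"
  proof (intro sum.cong refl)
    fix u w assume uw: "u \<in> basis_on {q}" "w \<in> basis_on A"
    have "(\<Prod>i\<in>A. h i (sup u w i)) = (\<Prod>i\<in>A. h i (w i))"
      using uw insert.hyps by (intro prod.cong refl)
        (simp only: sup_right[of "{q}" A u] Int_insert_left_if0 Int_empty_left not_False_eq_True)
    moreover have "sup u w q = u q"
      using uw insert.hyps by (intro sup_left[of "{q}" A]) auto
    ultimately show "(\<Prod>i\<in>insert q A. h i (sup u w i)) = h q (u q) * (\<Prod>i\<in>A. h i (w i))"
      using insert.hyps by simp
  qed
  also have "\<dots> = (\<Sum>v\<in>UNIV. h q v) * (\<Sum>w\<in>basis_on A. \<Prod>i\<in>A. h i (w i))"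
    by (subst sum_basis_on_singleton)
      (simp add: sum_distrib_left[symmetric] sum_distrib_right[symmetric] del: UNIV_bool)
  finally show ?case using insert by simp
qed (simp add: basis_on_empty)

lemma apply_L_on_product:
  assumes AB: "finite A" "finite B" "A \<inter> B = {}"
    and psi: "\<And>u v. u \<in> basis_on A \<Longrightarrow> v \<in> basis_on B \<Longrightarrow> psi (sup u v) = \<alpha> u * \<beta> v"
    and uv: "u \<in> basis_on A" "v \<in> basis_on B"
  shows "apply_L_on (A \<union> B) gs psi (sup u v) = apply_L_on A gs \<alpha> u * apply_L_on B gs \<beta> v"
proof -
  have "(\<Prod>i\<in>A \<union> B. gs i (sup u v i) (sup s t i))
      = (\<Prod>i\<in>A. gs i (u i) (s i)) * (\<Prod>i\<in>B. gs i (v i) (t i))"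
    if "s \<in> basis_on A" "t \<in> basis_on B" for s t
  proof -
    have "(\<Prod>i\<in>A. gs i (sup u v i) (sup s t i)) = (\<Prod>i\<in>A. gs i (u i) (s i))"
      using AB uv that by (intro prod.cong refl) (simp only: sup_left)
    moreover have "(\<Prod>i\<in>B. gs i (sup u v i) (sup s t i)) = (\<Prod>i\<in>B. gs i (v i) (t i))"
      using AB uv that by (intro prod.cong refl) (simp only: sup_right)
    ultimately show ?thesis using AB by (subst prod.union_disjoint) auto
  qed
  then have "apply_L_on (A \<union> B) gs psi (sup u v) = (\<Sum>s\<in>basis_on A. \<Sum>t\<in>basis_on B.
      ((\<Prod>i\<in>A. gs i (u i) (s i)) * (\<Prod>i\<in>B. gs i (v i) (t i))) * (\<alpha> s * \<beta> t))"
    unfolding apply_L_on_def using AB psi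
    by (subst sum_basis_on_Un) (auto intro!: sum.cong)
  also have "\<dots> = (\<Sum>s\<in>basis_on A. \<Sum>t\<in>basis_on B.
      ((\<Prod>i\<in>A. gs i (u i) (s i)) * \<alpha> s) * ((\<Prod>i\<in>B. gs i (v i) (t i)) * \<beta> t))"
    by (simp add: mult_ac)
  also have "\<dots> = apply_L_on A gs \<alpha> u * apply_L_on B gs \<beta> v"
    unfolding apply_L_on_def by (simp add: sum_product)
  finally show ?thesis .
qed

lemma apply_M_product:
  assumes AB: "A \<inter> B = {}"
    and Ss: "finite Ss" "\<And>S. S \<in> Ss \<Longrightarrow> S \<noteq> {} \<and> (S \<subseteq> A \<or> S \<subseteq> B)"
    and psi: "psi (sup u v) = \<alpha> u * \<beta> v"
    and uv: "u \<in> basis_on A" "v \<in> basis_on B"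
  shows "apply_M {S \<in> Ss. S \<subseteq> A \<union> B} psi (sup u v)
    = apply_M {S \<in> Ss. S \<subseteq> A} \<alpha> u * apply_M {S \<in> Ss. S \<subseteq> B} \<beta> v"
proof -
  let ?g = "\<lambda>r S. if \<forall>i\<in>S. r i then - 1 else (1::complex)"
  have eq: "{S \<in> Ss. S \<subseteq> A \<union> B} = {S \<in> Ss. S \<subseteq> A} \<union> {S \<in> Ss. S \<subseteq> B}"
    using Ss(2) by auto
  \<comment> \<open>Nonemptiness matters here: an empty support would lie in both registers and its
    sign would be counted twice.\<close>
  have disj: "{S \<in> Ss. S \<subseteq> A} \<inter> {S \<in> Ss. S \<subseteq> B} = {}"
    using Ss(2) AB by blast
  have "prod (?g (sup u v)) {S \<in> Ss. S \<subseteq> A \<union> B}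
      = prod (?g (sup u v)) {S \<in> Ss. S \<subseteq> A} * prod (?g (sup u v)) {S \<in> Ss. S \<subseteq> B}"
    unfolding eq by (rule prod.union_disjoint) (use Ss disj in auto)
  also have "prod (?g (sup u v)) {S \<in> Ss. S \<subseteq> A} = prod (?g u) {S \<in> Ss. S \<subseteq> A}"
  proof (rule prod.cong)
    fix S assume "S \<in> {S \<in> Ss. S \<subseteq> A}"
    then have "(\<forall>i\<in>S. sup u v i) \<longleftrightarrow> (\<forall>i\<in>S. u i)"
      using sup_left[OF AB uv(2)] by blast
    then show "?g (sup u v) S = ?g u S" by presburger
  qed simp
  also have "prod (?g (sup u v)) {S \<in> Ss. S \<subseteq> B} = prod (?g v) {S \<in> Ss. S \<subseteq> B}"
  proof (rule prod.cong)
    fix S assume "S \<in> {S \<in> Ss. S \<subseteq> B}"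
    then have "(\<forall>i\<in>S. sup u v i) \<longleftrightarrow> (\<forall>i\<in>S. v i)"
      using sup_right[OF AB uv(1)] by blast
    then show "?g (sup u v) S = ?g v S" by presburger
  qed simp
  finally show ?thesis unfolding apply_M_def psi by (simp add: mult_ac)
qed

text \<open>No CZ support crosses the cut between \<open>A\<close> and \<open>B\<close>, hence no
  layer entangles the two registers.\<close>

lemma run_on_product:
  assumes AB: "finite A" "finite B" "A \<inter> B = {}"
    and Ss: "\<And>j. j \<in> {1..k} \<Longrightarrow> finite (snd C j)"
      "\<And>j S. j \<in> {1..k} \<Longrightarrow> S \<in> snd C j \<Longrightarrow> S \<noteq> {} \<and> (S \<subseteq> A \<or> S \<subseteq> B)"
    and psi: "\<And>u v. u \<in> basis_on A \<Longrightarrow> v \<in> basis_on B \<Longrightarrow> psi (sup u v) = \<alpha> u * \<beta> v"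
    and uv: "u \<in> basis_on A" "v \<in> basis_on B"
  shows "run_on (A \<union> B) C k psi (sup u v) = run_on A C k \<alpha> u * run_on B C k \<beta> v"
  using Ss uv
proof (induction k arbitrary: u v)
  case 0
  then show ?case
    unfolding run_on.simps by (intro apply_L_on_product[OF AB] psi)
next
  case (Suc k)
  have "run_on (A \<union> B) C k psi (sup u v) = run_on A C k \<alpha> u * run_on B C k \<beta> v"
    if "u \<in> basis_on A" "v \<in> basis_on B" for u v
  proof (rule Suc.IH[OF _ _ that])
    show "finite (snd C j)" if "j \<in> {1..k}" for j
      using that by (intro Suc.prems(1)) simp
    show "S \<noteq> {} \<and> (S \<subseteq> A \<or> S \<subseteq> B)" if "j \<in> {1..k}" "S \<in> snd C j" for j S
      using that by (intro Suc.prems(2)[of j]) simp_all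
  qed
  then show ?case
    unfolding run_on.simps
    using Suc.prems(1)[of "Suc k"] Suc.prems(2)[of "Suc k"] Suc.prems(3,4)
    by (intro apply_L_on_product[OF AB] apply_M_product[OF AB(3)]) auto
qed

lemma prob_on_product:
  assumes AB: "A \<inter> B = {}" and q: "q \<in> A"
    and psi: "\<And>u v. u \<in> basis_on A \<Longrightarrow> v \<in> basis_on B \<Longrightarrow> psi (sup u v) = \<alpha> u * \<beta> v"
  shows "prob_on (A \<union> B) q x psi = prob_on A q x \<alpha> * norm2_on B \<beta>"
proof -
  have "prob_on (A \<union> B) q x psi = (\<Sum>u\<in>basis_on A. \<Sum>v\<in>basis_on B.
      (if u q = x then (cmod (\<alpha> u))\<^sup>2 else 0) * (cmod (\<beta> v))\<^sup>2)"
    unfolding prob_on_def sum_basis_on_Un[OF AB]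
  proof (intro sum.cong refl)
    fix u v assume uv: "u \<in> basis_on A" "v \<in> basis_on B"
    show "(if sup u v q = x then (cmod (psi (sup u v)))\<^sup>2 else 0)
        = (if u q = x then (cmod (\<alpha> u))\<^sup>2 else 0) * (cmod (\<beta> v))\<^sup>2"
      unfolding psi[OF uv] sup_left[OF AB uv(2) q]
      by (simp add: norm_mult power_mult_distrib)
  qed
  then show ?thesis by (simp add: prob_on_def norm2_on_def sum_product)
qed

section \<open>Unitarity\<close>

text \<open>A right inverse of a square matrix is also a left inverse: \<open>unitary1\<close> gives
  orthonormal rows, while preservation of the norm needs orthonormal columns.\<close>

lemma unitary1_columns:
  assumes "unitary1 g"
  shows "(\<Sum>a\<in>UNIV. cnj (g a b) * g a b') = (if b = b' then 1 else 0)"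
proof -
  define p q r s where "p = g True True" "q = g True False" "r = g False True" "s = g False False"
  have u: "\<And>a b. (\<Sum>c\<in>UNIV. g a c * cnj (g b c)) = (if a = b then 1 else 0)"
    using assms by (auto simp: unitary1_def)
  have e: "p * cnj p + q * cnj q = 1" "r * cnj r + s * cnj s = 1"
      "p * cnj r + q * cnj s = 0" "r * cnj p + s * cnj q = 0"
    using u[of True True] u[of False False] u[of True False] u[of False True]
    by (simp_all add: UNIV_bool p_q_r_s_def add.commute)
  \<comment> \<open>For two by two matrices this follows by polynomial algebra in the entries and
    their conjugates, taken as independent variables.\<close>
  have "cnj p * p + cnj r * r = 1" "cnj q * q + cnj s * s = 1"
      "cnj p * q + cnj r * s = 0" "cnj q * p + cnj s * r = 0"
    using e by algebra+
  then show ?thesis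
    by (cases b; cases b') (simp_all add: UNIV_bool p_q_r_s_def add.commute)
qed

text \<open>Needed because depth counts CZ layers: when two circuits are composed, their adjoining
  single-qubit layers must merge into one.\<close>

definition gate_mult :: "gate1 \<Rightarrow> gate1 \<Rightarrow> gate1" where
  "gate_mult g h = (\<lambda>a b. \<Sum>c\<in>UNIV. g a c * h c b)"

definition gate_id :: gate1 where
  "gate_id = (\<lambda>a b. if a = b then 1 else 0)"

lemma unitary1_gate_id: "unitary1 gate_id"
  by (auto simp: unitary1_def gate_id_def UNIV_bool)

lemma unitary1_gate_mult:
  assumes "unitary1 g" "unitary1 h"
  shows "unitary1 (gate_mult g h)"
  unfolding unitary1_def
proof (intro allI)
  fix a b
  have "(\<Sum>c\<in>UNIV. gate_mult g h a c * cnj (gate_mult g h b c))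
     = (\<Sum>c\<in>UNIV. \<Sum>d\<in>UNIV. g a c * cnj (g b d) * (\<Sum>e\<in>UNIV. h c e * cnj (h d e)))"
    by (simp add: gate_mult_def UNIV_bool algebra_simps)
  also have "\<dots> = (\<Sum>c\<in>UNIV. g a c * cnj (g b c))"
    using assms(2) by (simp add: unitary1_def UNIV_bool del: sum.insert) (simp add: UNIV_bool)
  also have "\<dots> = (if a = b then 1 else 0)" using assms(1) by (simp add: unitary1_def)
  finally show "(\<Sum>c\<in>UNIV. gate_mult g h a c * cnj (gate_mult g h b c)) = (if a = b then 1 else 0)" .
qed

lemma apply_L_on_mult:
  assumes "finite A"
  shows "apply_L_on A g (apply_L_on A h psi) = apply_L_on A (\<lambda>i. gate_mult (g i) (h i)) psi"
proof
  fix r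
  have "apply_L_on A g (apply_L_on A h psi) r = (\<Sum>s\<in>basis_on A. \<Sum>t\<in>basis_on A.
      ((\<Prod>i\<in>A. g i (r i) (s i) * h i (s i) (t i)) * psi t))"
    by (simp add: apply_L_on_def sum_distrib_left prod.distrib mult_ac)
  also have "\<dots> = (\<Sum>t\<in>basis_on A. (\<Sum>s\<in>basis_on A. \<Prod>i\<in>A. g i (r i) (s i) * h i (s i) (t i)) * psi t)"
    by (subst sum.swap) (simp add: sum_distrib_right)
  also have "\<dots> = (\<Sum>t\<in>basis_on A. (\<Prod>i\<in>A. \<Sum>c\<in>UNIV. g i (r i) c * h i c (t i)) * psi t)"
    by (intro sum.cong refl arg_cong2[of _ _ _ _ "(*)"] sum_basis_on_prod[OF assms])
  finally show "apply_L_on A g (apply_L_on A h psi) r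
      = apply_L_on A (\<lambda>i. gate_mult (g i) (h i)) psi r"
    by (simp add: apply_L_on_def gate_mult_def)
qed

text \<open>The Gram matrix of the columns of a tensor product is the product of the single-qubit
  Gram matrices, hence the identity; expanding the squared norm then leaves only the
  diagonal.\<close>

lemma norm2_on_apply_L_on:
  assumes A: "finite A" and g: "\<And>i. i \<in> A \<Longrightarrow> unitary1 (g i)"
  shows "norm2_on A (apply_L_on A g psi) = norm2_on A psi"
proof -
  have cols: "(\<Sum>r\<in>basis_on A. \<Prod>i\<in>A. cnj (g i (r i) (s i)) * g i (r i) (t i)) = (if s = t then 1 else 0)"
    if "s \<in> basis_on A" "t \<in> basis_on A" for s t
  proof -
    have "(\<Sum>r\<in>basis_on A. \<Prod>i\<in>A. cnj (g i (r i) (s i)) * g i (r i) (t i))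
        = (\<Prod>i\<in>A. if s i = t i then 1 else 0)"
      by (subst sum_basis_on_prod[OF A]) (intro prod.cong refl unitary1_columns g)
    moreover have "s = t \<longleftrightarrow> (\<forall>i\<in>A. s i = t i)"
      using that by (auto simp: basis_on_def fun_eq_iff)
    ultimately show ?thesis using A by auto
  qed
  let ?G = "\<lambda>r s. \<Prod>i\<in>A. g i (r i) (s i)"
  have "complex_of_real (norm2_on A (apply_L_on A g psi))
      = (\<Sum>r\<in>basis_on A. cnj (\<Sum>s\<in>basis_on A. ?G r s * psi s) * (\<Sum>t\<in>basis_on A. ?G r t * psi t))"
    unfolding norm2_on_def apply_L_on_def of_real_sum complex_norm_square
    by (simp add: mult.commute)
  also have "\<dots> = (\<Sum>r\<in>basis_on A. \<Sum>s\<in>basis_on A. \<Sum>t\<in>basis_on A.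
      (\<Prod>i\<in>A. cnj (g i (r i) (s i)) * g i (r i) (t i)) * (cnj (psi s) * psi t))"
    by (simp only: cnj_sum sum_product) (simp add: prod.distrib mult_ac)
  also have "\<dots> = (\<Sum>s\<in>basis_on A. \<Sum>t\<in>basis_on A. \<Sum>r\<in>basis_on A.
      (\<Prod>i\<in>A. cnj (g i (r i) (s i)) * g i (r i) (t i)) * (cnj (psi s) * psi t))"
    by (subst sum.swap) (intro sum.cong refl sum.swap)
  also have "\<dots> = (\<Sum>s\<in>basis_on A. \<Sum>t\<in>basis_on A. (if s = t then 1 else 0) * (cnj (psi s) * psi t))"
    unfolding sum_distrib_right[symmetric] by (intro sum.cong refl) (simp only: cols)
  also have "\<dots> = (\<Sum>s\<in>basis_on A. cnj (psi s) * psi s)"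
    using finite_basis_on[OF A] by (simp add: if_distrib[of "\<lambda>x. x * _"] cong: if_cong)
  also have "\<dots> = complex_of_real (norm2_on A psi)"
    unfolding norm2_on_def of_real_sum complex_norm_square by (simp add: mult.commute)
  finally show ?thesis by (simp only: of_real_eq_iff)
qed

lemma norm2_on_apply_M: "norm2_on A (apply_M Ss psi) = norm2_on A psi"
proof -
  have "cmod (\<Prod>S\<in>Ss. if \<forall>i\<in>S. r i then - 1 else 1) = 1" for r :: "nat \<Rightarrow> bool"
    unfolding prod_norm[symmetric] by (rule prod.neutral) auto
  then show ?thesis by (simp add: norm2_on_def apply_M_def norm_mult)
qed

lemma norm2_on_run_on:
  assumes "finite A" "\<And>j i. j \<le> k \<Longrightarrow> i \<in> A \<Longrightarrow> unitary1 (fst C j i)"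
  shows "norm2_on A (run_on A C k psi) = norm2_on A psi"
  using assms(2) by (induction k) (simp_all add: norm2_on_apply_L_on[OF assms(1)] norm2_on_apply_M)

section \<open>Linearity and probabilities of superpositions\<close>

lemma apply_L_on_add:
  "apply_L_on A g (\<lambda>r. psi r + phi r) = (\<lambda>r. apply_L_on A g psi r + apply_L_on A g phi r)"
  by (simp add: apply_L_on_def ring_distribs sum.distrib)

text \<open>Used to follow two parts of a state separately: the part with correct block parities and
  the rest.\<close>

lemma run_on_add:
  "run_on A C k (\<lambda>r. psi r + phi r) = (\<lambda>r. run_on A C k psi r + run_on A C k phi r)"
  by (induction k) (simp_all add: apply_L_on_add apply_M_def ring_distribs)

lemma prob_on_nonneg: "0 \<le> prob_on A q v psi"
  by (auto simp: prob_on_def intro: sum_nonneg)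

lemma norm2_on_nonneg: "0 \<le> norm2_on A psi"
  by (auto simp: norm2_on_def intro: sum_nonneg)

lemma prob_on_le_norm2_on: "prob_on A q v psi \<le> norm2_on A psi"
  unfolding prob_on_def norm2_on_def by (rule sum_mono) simp

text \<open>Comes from \<open>|x + y|^2 <= 2 |x|^2 + 2 |y|^2\<close>, with no relation assumed
  between the summands; this factor 2 is the source of the constant growth of the error per
  level.\<close>

lemma prob_on_add_le:
  "prob_on A q v (\<lambda>r. psi r + phi r) \<le> 2 * prob_on A q v psi + 2 * prob_on A q v phi"
proof -
  have *: "(cmod (x + y))\<^sup>2 \<le> 2 * (cmod x)\<^sup>2 + 2 * (cmod y)\<^sup>2" for x y
  proof -
    have "(cmod (x + y))\<^sup>2 \<le> (cmod x + cmod y)\<^sup>2"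
      by (intro power_mono norm_triangle_ineq) simp
    also have "\<dots> \<le> 2 * (cmod x)\<^sup>2 + 2 * (cmod y)\<^sup>2"
      using sum_squares_bound[of "cmod x" "cmod y"] by (simp add: power2_sum)
    finally show ?thesis .
  qed
  show ?thesis
    unfolding prob_on_def sum_distrib_left sum.distrib[symmetric]
    by (intro sum_mono) (simp add: *)
qed

section \<open>Relabelling, parallel and sequential composition\<close>

text \<open>Reads the wires \<open>h 0\<close>, ..., \<open>h (m - 1)\<close> as a standard
  register; bits from \<open>m\<close> on are cleared so that the result lies in
  \<open>basis_on {..<m}\<close>.\<close>

definition pull :: "(nat \<Rightarrow> nat) \<Rightarrow> nat \<Rightarrow> (nat \<Rightarrow> bool) \<Rightarrow> nat \<Rightarrow> bool" where
  "pull h m r = (\<lambda>i. i < m \<and> r (h i))"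

lemma bij_betw_pull:
  assumes "bij_betw h {..<m} A"
  shows "bij_betw (pull h m) (basis_on A) (basis_on {..<m})"
proof (rule bij_betw_byWitness[where f' = "\<lambda>s q. q \<in> A \<and> s (inv_into {..<m} h q)"])
  have h: "h ` {..<m} = A" "inj_on h {..<m}" using assms by (auto simp: bij_betw_def)
  show "\<forall>r\<in>basis_on A. (\<lambda>q. q \<in> A \<and> pull h m r (inv_into {..<m} h q)) = r"
  proof (intro ballI ext)
    fix r q assume "r \<in> basis_on A"
    then show "(q \<in> A \<and> pull h m r (inv_into {..<m} h q)) = r q"
      using h f_inv_into_f[of q h "{..<m}"] inv_into_into[of q h "{..<m}"]
      by (cases "q \<in> A") (simp_all add: pull_def basis_on_def)
  qed
  show "\<forall>s\<in>basis_on {..<m}. pull h m (\<lambda>q. q \<in> A \<and> s (inv_into {..<m} h q)) = s"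
  proof (intro ballI ext)
    fix s i assume "s \<in> basis_on {..<m}"
    then show "pull h m (\<lambda>q. q \<in> A \<and> s (inv_into {..<m} h q)) i = s i"
      using h by (cases "i < m") (auto simp: pull_def basis_on_def inv_into_f_f)
  qed
qed (auto simp: pull_def basis_on_def)

lemma pull_sup_left:
  assumes "\<And>i. i < m \<Longrightarrow> h i \<in> A" "A \<inter> B = {}" "w \<in> basis_on B"
  shows "pull h m (sup u w) = pull h m u"
  using assms by (auto simp: pull_def basis_on_def fun_eq_iff)

text \<open>The sums and products of each layer are reindexed along \<open>pull\<close> and
  \<open>h\<close>. This identifies a copy of a circuit inside a larger register with the
  original.\<close>

lemma run_on_relabel:
  assumes h: "bij_betw h {..<m} A"
    and L: "\<And>j i. j \<le> k \<Longrightarrow> i < m \<Longrightarrow> fst C' j (h i) = fst C j i"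
    and M: "\<And>j. j \<in> {1..k} \<Longrightarrow> {S \<in> snd C' j. S \<subseteq> A} = (`) h ` {S \<in> snd C j. S \<subseteq> {..<m}}"
    and psi: "\<And>r. r \<in> basis_on A \<Longrightarrow> \<alpha> r = \<alpha>' (pull h m r)"
    and r: "r \<in> basis_on A"
  shows "run_on A C' k \<alpha> r = run_on {..<m} C k \<alpha>' (pull h m r)"
proof -
  have hi: "h ` {..<m} = A" "inj_on h {..<m}" using h by (auto simp: bij_betw_def)
  have stepL: "apply_L_on A g' \<phi> r = apply_L_on {..<m} g \<phi>' (pull h m r)"
    if g: "\<And>i. i < m \<Longrightarrow> g' (h i) = g i" and \<phi>: "\<And>r. r \<in> basis_on A \<Longrightarrow> \<phi> r = \<phi>' (pull h m r)"
    for g' g \<phi> \<phi>' r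
  proof -
    have "(\<Prod>q\<in>A. g' q (r q) (s q)) = (\<Prod>i<m. g i (pull h m r i) (pull h m s i))" for s
      using g by (subst prod.reindex_bij_betw[OF h, symmetric]) (auto simp: pull_def)
    then have "apply_L_on A g' \<phi> r = (\<Sum>s\<in>basis_on A.
        (\<Prod>i<m. g i (pull h m r i) (pull h m s i)) * \<phi>' (pull h m s))"
      using \<phi> by (simp add: apply_L_on_def)
    also have "\<dots> = apply_L_on {..<m} g \<phi>' (pull h m r)"
      unfolding apply_L_on_def
      by (rule sum.reindex_bij_betw[OF bij_betw_pull[OF h]])
    finally show ?thesis .
  qed
  have stepM: "apply_M ((`) h ` Ss) \<phi> r = apply_M Ss \<phi>' (pull h m r)"
    if "\<phi> r = \<phi>' (pull h m r)" "\<And>S. S \<in> Ss \<Longrightarrow> S \<subseteq> {..<m}" for Ss \<phi> \<phi>' r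
  proof -
    have "inj_on ((`) h) Ss"
      using that(2) by (intro inj_on_subset[OF inj_on_image_Pow[OF hi(2)]]) auto
    moreover have "(\<forall>q\<in>h ` S. r q) \<longleftrightarrow> (\<forall>i\<in>S. pull h m r i)" if "S \<in> Ss" for S
      using \<open>\<And>S. S \<in> Ss \<Longrightarrow> S \<subseteq> {..<m}\<close>[OF that] by (auto simp: pull_def)
    ultimately show ?thesis
      unfolding apply_M_def that(1) by (simp add: prod.reindex cong: prod.cong)
  qed
  show ?thesis
    using L M r
  proof (induction k arbitrary: r)
    case 0
    then show ?case unfolding run_on.simps by (intro stepL psi) auto
  next
    case (Suc k)
    have IH: "run_on A C' k \<alpha> r = run_on {..<m} C k \<alpha>' (pull h m r)" if "r \<in> basis_on A" for r
    proof (rule Suc.IH[OF _ _ that])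
      show "fst C' j (h i) = fst C j i" if "j \<le> k" "i < m" for i j
        using that by (intro Suc.prems(1)) simp_all
      show "{S \<in> snd C' j. S \<subseteq> A} = (`) h ` {S \<in> snd C j. S \<subseteq> {..<m}}" if "j \<in> {1..k}" for j
        using that by (intro Suc.prems(2)) simp
    qed
    have "{S \<in> snd C' (Suc k). S \<subseteq> A} = (`) h ` {S \<in> snd C (Suc k). S \<subseteq> {..<m}}"
      by (intro Suc.prems(2)) simp
    then show ?case
      unfolding run_on.simps
      using Suc.prems(1)[of "Suc k"] by (auto intro!: stepL stepM IH)
  qed
qed

text \<open>\<open>F (\<kappa>, i)\<close> is the wire carrying qubit \<open>i\<close> of the \<open>\<kappa>\<close>-th of \<open>k\<close> copies of \<open>C\<close>.\<close>

definition parallel :: "(nat \<times> nat \<Rightarrow> nat) \<Rightarrow> nat \<Rightarrow> nat \<Rightarrow> circuit \<Rightarrow> circuit" where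
  "parallel F k m C =
    (\<lambda>j q. if q \<in> F ` ({..<k} \<times> {..<m})
           then fst C j (snd (inv_into ({..<k} \<times> {..<m}) F q)) else gate_id,
     \<lambda>j. \<Union>\<kappa><k. (`) (\<lambda>i. F (\<kappa>, i)) ` snd C j)"

lemma qac0_circuit_parallel:
  assumes F: "inj_on F ({..<k} \<times> {..<m})" "F ` ({..<k} \<times> {..<m}) \<subseteq> {..<N}"
    and C: "qac0_circuit m d C"
  shows "qac0_circuit N d (parallel F k m C)"
  unfolding qac0_circuit_def
proof (intro conjI allI impI ballI)
  fix j q assume "j \<le> d" "q < N"
  moreover have "snd (inv_into ({..<k} \<times> {..<m}) F q) < m" if "q \<in> F ` ({..<k} \<times> {..<m})"
    using inv_into_into[OF that] by auto
  ultimately show "unitary1 (fst (parallel F k m C) j q)"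
    using C unitary1_gate_id by (auto simp: parallel_def qac0_circuit_def)
next
  fix j assume "j \<in> {1..d}"
  then have cz: "cz_layer m (snd C j)" using C by (auto simp: qac0_circuit_def)
  \<comment> \<open>Two gates from different copies are separated by injectivity of
    \<open>F\<close>; two from the same copy, by disjointness of the supports in the layer of
    \<open>C\<close>.\<close>
  have *: "(\<lambda>i. F (\<kappa>, i)) ` S \<inter> (\<lambda>i. F (\<kappa>', i)) ` T = {}"
    if "\<kappa> < k" "\<kappa>' < k" "S \<in> snd C j" "T \<in> snd C j" "\<not> (\<kappa> = \<kappa>' \<and> S = T)" for \<kappa> \<kappa>' S T
  proof -
    have ST: "S \<subseteq> {..<m}" "T \<subseteq> {..<m}" "S = T \<or> S \<inter> T = {}"
      using cz that unfolding cz_layer_def by blast+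
    have "(\<kappa>, i) = (\<kappa>', i')" if "i \<in> S" "i' \<in> T" "F (\<kappa>, i) = F (\<kappa>', i')" for i i'
      using that ST(1,2) \<open>\<kappa> < k\<close> \<open>\<kappa>' < k\<close> by (intro inj_onD[OF F(1)]) auto
    then show ?thesis using ST(3) that(5) by blast
  qed
  show "cz_layer N (snd (parallel F k m C) j)"
    unfolding cz_layer_def
  proof (intro conjI ballI impI)
    fix S assume "S \<in> snd (parallel F k m C) j"
    then obtain \<kappa> S' where S: "\<kappa> < k" "S' \<in> snd C j" "S = (\<lambda>i. F (\<kappa>, i)) ` S'"
      by (auto simp: parallel_def)
    have S': "S' \<noteq> {}" "S' \<subseteq> {..<m}" using cz S(2) by (auto simp: cz_layer_def)
    show "S \<noteq> {}" using S S' by simp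
    show "S \<subseteq> {..<N}" using S S' F(2) by blast
    fix T assume "T \<in> snd (parallel F k m C) j" and ne: "S \<noteq> T"
    then obtain \<kappa>' T' where T: "\<kappa>' < k" "T' \<in> snd C j" "T = (\<lambda>i. F (\<kappa>', i)) ` T'"
      by (auto simp: parallel_def)
    show "S \<inter> T = {}"
      unfolding S(3) T(3) by (rule *) (use S T ne in auto)
  qed
qed

lemma parallel_gate:
  assumes "inj_on F ({..<k} \<times> {..<m})" "\<kappa> < k" "i < m"
  shows "fst (parallel F k m C) j (F (\<kappa>, i)) = fst C j i"
  using assms by (simp add: parallel_def inv_into_f_f)

lemma indicator_norm2_on:
  assumes "finite A" "z \<in> basis_on A"
  shows "norm2_on A (\<lambda>r. if r = z then 1 else 0) = 1"
proof -
  have "norm2_on A (\<lambda>r. if r = z then 1 else 0) = (\<Sum>r\<in>basis_on A. if r = z then 1 else 0)"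
    unfolding norm2_on_def by (intro sum.cong) auto
  then show ?thesis using assms finite_basis_on by simp
qed

lemma norm2_on_product:
  assumes AB: "A \<inter> B = {}"
    and psi: "\<And>u v. u \<in> basis_on A \<Longrightarrow> v \<in> basis_on B \<Longrightarrow> psi (sup u v) = \<alpha> u * \<beta> v"
  shows "norm2_on (A \<union> B) psi = norm2_on A \<alpha> * norm2_on B \<beta>"
  unfolding norm2_on_def sum_basis_on_Un[OF AB] sum_product
  by (intro sum.cong refl) (simp only: psi norm_mult power_mult_distrib)

text \<open>A state whose restriction to one block is the basis state \<open>t\<close> is a product state across that
  block and the remaining wires, so the block behaves as if the circuit were run on \<open>t\<close> in isolation.\<close>

lemma prob_on_parallel_block:
  assumes F: "inj_on F ({..<k} \<times> {..<m})" "F ` ({..<k} \<times> {..<m}) \<subseteq> {..<N}"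
    and C: "qac0_circuit m d C" and \<kappa>: "\<kappa> < k" and m: "0 < m"
    and t: "t \<in> basis_on {..<m}"
    and supp: "\<And>r. r \<in> basis_on {..<N} \<Longrightarrow> psi r \<noteq> 0 \<Longrightarrow> pull (\<lambda>i. F (\<kappa>, i)) m r = t"
  shows "prob_on {..<N} (F (\<kappa>, 0)) v (run_on {..<N} (parallel F k m C) d psi)
    = prob_on {..<m} 0 v (run_on {..<m} C d (\<lambda>r. if r = t then 1 else 0)) * norm2_on {..<N} psi"
proof -
  define h where "h = (\<lambda>i. F (\<kappa>, i))"
  define A where "A = h ` {..<m}"
  define B where "B = {..<N} - A"
  let ?P = "parallel F k m C"
  have inj: "inj_on h {..<m}"
    using F(1) \<kappa> by (auto simp: inj_on_def h_def)
  then have h: "bij_betw h {..<m} A" by (simp add: A_def bij_betw_def)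
  have hA: "h i \<in> A" if "i < m" for i using that by (simp add: A_def)
  have AN: "A \<subseteq> {..<N}" using F(2) \<kappa> by (auto simp: A_def h_def)
  then have AB: "finite A" "finite B" "A \<inter> B = {}" and N: "{..<N} = A \<union> B"
    by (auto simp: B_def intro: finite_subset)
  have P: "qac0_circuit N d ?P" by (rule qac0_circuit_parallel[OF F C])
  \<comment> \<open>No CZ gate joins the block to the other wires: it belongs either to copy
    \<open>\<kappa>\<close> or to another copy, whose wires are disjoint from
    \<open>A\<close>.\<close>
  have blocks: "S \<noteq> {} \<and> (S \<subseteq> A \<or> S \<subseteq> B)" if j: "j \<in> {1..d}" and S: "S \<in> snd ?P j" for j S
  proof -
    obtain \<kappa>' S' where S': "\<kappa>' < k" "S' \<in> snd C j" "S = (\<lambda>i. F (\<kappa>', i)) ` S'"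
      using S by (auto simp: parallel_def)
    have S'm: "S' \<noteq> {}" "S' \<subseteq> {..<m}"
      using C j S'(2) by (auto simp: qac0_circuit_def cz_layer_def)
    show ?thesis
    proof (cases "\<kappa>' = \<kappa>")
      case True
      then show ?thesis using S' S'm by (auto simp: A_def h_def)
    next
      case False
      have "F (\<kappa>', i) \<noteq> F (\<kappa>, i')" if "i < m" "i' < m" for i i'
        using False that \<kappa> S'(1) inj_onD[OF F(1), of "(\<kappa>', i)" "(\<kappa>, i')"] by auto
      then have "S \<inter> A = {}" using S' S'm by (auto simp: A_def h_def)
      moreover have "S \<subseteq> {..<N}" using F(2) S' S'm by blast
      ultimately show ?thesis using S' S'm by (auto simp: B_def)
    qed
  qed
  have block_layer: "{S \<in> snd ?P j. S \<subseteq> A} = (`) h ` {S \<in> snd C j. S \<subseteq> {..<m}}"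
    if j: "j \<in> {1..d}" for j
  proof (intro equalityI subsetI)
    have Cj: "S' \<noteq> {}" "S' \<subseteq> {..<m}" if "S' \<in> snd C j" for S'
      using C j that by (auto simp: qac0_circuit_def cz_layer_def)
    fix S assume "S \<in> {S \<in> snd ?P j. S \<subseteq> A}"
    then obtain \<kappa>' S' where S': "\<kappa>' < k" "S' \<in> snd C j" "S = (\<lambda>i. F (\<kappa>', i)) ` S'" "S \<subseteq> A"
      by (auto simp: parallel_def)
    obtain i where i: "i \<in> S'" "i < m" using Cj[OF S'(2)] by auto
    then obtain i' where "i' < m" "F (\<kappa>', i) = F (\<kappa>, i')" using S' by (auto simp: A_def h_def)
    then have "\<kappa>' = \<kappa>"
      using inj_onD[OF F(1), of "(\<kappa>', i)" "(\<kappa>, i')"] i \<kappa> S'(1) by auto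
    then show "S \<in> (`) h ` {S \<in> snd C j. S \<subseteq> {..<m}}"
      using S' Cj by (auto simp: h_def)
  next
    fix S assume "S \<in> (`) h ` {S \<in> snd C j. S \<subseteq> {..<m}}"
    then show "S \<in> {S \<in> snd ?P j. S \<subseteq> A}"
      using \<kappa> by (auto simp: parallel_def h_def A_def)
  qed
  let ?I = "\<lambda>r. if r = t then 1 else (0::complex)"
  define \<alpha> where "\<alpha> = (\<lambda>u. ?I (pull h m u))"
  obtain u0 where u0: "u0 \<in> basis_on A" "pull h m u0 = t"
    using bij_betw_imp_surj_on[OF bij_betw_pull[OF h]] t by (metis imageE)
  have u0_eq: "u = u0" if "u \<in> basis_on A" "pull h m u = t" for u
    using bij_betw_pull[OF h] that u0 by (auto simp: bij_betw_def inj_on_def)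
  \<comment> \<open>\<open>\<beta>\<close> is the slice of \<open>psi\<close> at \<open>u0\<close>,
    the only string of the block that reads as \<open>t\<close>; by \<open>supp\<close> all other
    slices vanish.\<close>
  define \<beta> where "\<beta> = (\<lambda>w. psi (sup u0 w))"
  have psi: "psi (sup u w) = \<alpha> u * \<beta> w" if uw: "u \<in> basis_on A" "w \<in> basis_on B" for u w
  proof (cases "pull h m u = t")
    case True
    then show ?thesis using u0_eq[OF uw(1)] by (simp add: \<alpha>_def \<beta>_def)
  next
    case False
    then have "pull h m (sup u w) \<noteq> t" using pull_sup_left[OF hA AB(3) uw(2)] by simp
    then have "psi (sup u w) = 0"
      using supp[of "sup u w"] sup_in_basis_on[OF uw] N by (auto simp: h_def)
    then show ?thesis using False by (simp add: \<alpha>_def)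
  qed
  have q: "F (\<kappa>, 0) \<in> A" using m by (auto simp: A_def h_def)
  have fin: "finite (snd ?P j)" if "j \<in> {1..d}" for j
    using P that by (intro cz_layer_finite[of N]) (simp add: qac0_circuit_def)
  have norm_a: "norm2_on A \<alpha> = 1"
  proof -
    have "pull h m u = t \<longleftrightarrow> u = u0" if "u \<in> basis_on A" for u
      using u0_eq[OF that] u0(2) by blast
    then have "norm2_on A \<alpha> = norm2_on A (\<lambda>u. if u = u0 then 1 else 0)"
      unfolding norm2_on_def \<alpha>_def by (intro sum.cong refl) simp
    then show ?thesis using indicator_norm2_on[OF AB(1) u0(1)] by simp
  qed
  have "prob_on {..<N} (F (\<kappa>, 0)) v (run_on {..<N} ?P d psi)
      = prob_on A (F (\<kappa>, 0)) v (run_on A ?P d \<alpha>) * norm2_on B (run_on B ?P d \<beta>)"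
    unfolding N
    by (intro prob_on_product[OF AB(3) q] run_on_product[OF AB] fin blocks psi)
  \<comment> \<open>Whatever happens on the other wires is unitary and enters the outcome on the
    block only through the norm of \<open>psi\<close>.\<close>
  also have "norm2_on B (run_on B ?P d \<beta>) = norm2_on B \<beta>"
    using P by (intro norm2_on_run_on AB) (auto simp: qac0_circuit_def B_def)
  also have "norm2_on B \<beta> = norm2_on {..<N} psi"
    unfolding N using norm2_on_product[OF AB(3), of psi \<alpha> \<beta>] psi norm_a by simp
  also have "prob_on A (F (\<kappa>, 0)) v (run_on A ?P d \<alpha>) = prob_on {..<m} 0 v (run_on {..<m} C d ?I)"
  proof -
    have "run_on A ?P d \<alpha> r = run_on {..<m} C d ?I (pull h m r)" if "r \<in> basis_on A" for r
      using that
      by (intro run_on_relabel[OF h]) (auto simp: \<alpha>_def h_def parallel_gate[OF F(1) \<kappa>] block_layer[unfolded h_def])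
    then have "prob_on A (F (\<kappa>, 0)) v (run_on A ?P d \<alpha>)
        = (\<Sum>r\<in>basis_on A. if pull h m r 0 = v then (cmod (run_on {..<m} C d ?I (pull h m r)))\<^sup>2 else 0)"
      unfolding prob_on_def using m by (intro sum.cong) (auto simp: pull_def h_def)
    also have "\<dots> = prob_on {..<m} 0 v (run_on {..<m} C d ?I)"
      unfolding prob_on_def by (rule sum.reindex_bij_betw[OF bij_betw_pull[OF h]])
    finally show ?thesis .
  qed
  finally show ?thesis .
qed

text \<open>CZ layers are diagonal, so only single-qubit gates can change a bit; an identity gate
  keeps the wire at the value \<open>v\<close> it has throughout the support of the state.\<close>

lemma run_on_idle_wire:
  assumes A: "finite A" "q \<in> A" and idle: "\<And>j. fst C j q = gate_id"
    and psi: "\<And>r. r \<in> basis_on A \<Longrightarrow> r q \<noteq> v \<Longrightarrow> psi r = 0"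
    and r: "r \<in> basis_on A" "r q \<noteq> v"
  shows "run_on A C k psi r = 0"
proof -
  have step: "apply_L_on A (fst C j) \<phi> r = 0"
    if "\<And>r. r \<in> basis_on A \<Longrightarrow> r q \<noteq> v \<Longrightarrow> \<phi> r = 0" "r q \<noteq> v" for j \<phi> r
    unfolding apply_L_on_def
  proof (intro sum.neutral ballI)
    fix s assume s: "s \<in> basis_on A"
    show "(\<Prod>i\<in>A. fst C j i (r i) (s i)) * \<phi> s = 0"
    proof (cases "s q = v")
      case True
      then have "fst C j q (r q) (s q) = 0" using that(2) idle by (simp add: gate_id_def)
      then have "(\<Prod>i\<in>A. fst C j i (r i) (s i)) = 0" using A by (intro prod_zero) auto
      then show ?thesis by simp
    qed (use that(1) s in simp)
  qed
  show ?thesis using r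
  proof (induction k arbitrary: r)
    case 0
    then show ?case by (simp add: step psi)
  next
    case (Suc k)
    then show ?case unfolding run_on.simps by (intro step) (auto simp: apply_M_def)
  qed
qed

text \<open>Layer \<open>d\<close> is shared between the circuits so that the CZ depths add
  exactly.\<close>

definition sequential :: "nat \<Rightarrow> circuit \<Rightarrow> circuit \<Rightarrow> circuit" where
  "sequential d C1 C2 =
    (\<lambda>j. if j < d then fst C1 j
         else if j = d then (\<lambda>i. gate_mult (fst C2 0 i) (fst C1 d i)) else fst C2 (j - d),
     \<lambda>j. if j \<le> d then snd C1 j else snd C2 (j - d))"

lemma qac0_circuit_sequential:
  assumes "qac0_circuit m d1 C1" "qac0_circuit m d2 C2"
  shows "qac0_circuit m (d1 + d2) (sequential d1 C1 C2)"
proof -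
  have "j - d1 \<in> {1..d2}" if "j \<in> {1..d1 + d2}" "\<not> j \<le> d1" for j
    using that by auto
  then show ?thesis
    using assms
    by (auto simp: qac0_circuit_def sequential_def simp del: atLeastAtMost_iff
        intro!: unitary1_gate_mult) auto
qed

lemma run_on_sequential:
  assumes "finite A"
  shows "run_on A (sequential d C1 C2) (d + k) psi = run_on A C2 k (run_on A C1 d psi)"
proof (induction k)
  case 0
  have pre: "run_on A (sequential d C1 C2) j psi = run_on A C1 j psi" if "j < d" for j
    using that by (induction j) (simp_all add: sequential_def)
  show ?case
  proof (cases d)
    case 0
    then show ?thesis by (simp add: sequential_def apply_L_on_mult[OF assms])
  next
    case (Suc d')
    then show ?thesis
      using pre[of d'] by (simp add: sequential_def apply_L_on_mult[OF assms])
  qed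
next
  case (Suc k)
  then show ?case by (simp add: sequential_def)
qed

section \<open>Trees of parity circuits\<close>

lemma input_in_basis_on: "n \<le> m \<Longrightarrow> (\<lambda>i. i < n \<and> x i) \<in> basis_on {..<m}"
  by (auto simp: basis_on_def)

lemma computes_parity_iff:
  "computes_parity n a d C eps \<longleftrightarrow> qac0_circuit (n + a) d C \<and>
    (\<forall>x. prob_on {..<n + a} 0 (\<not> parity n x) (run_on {..<n + a} C d (input_state n x)) \<le> eps)"
  by (auto simp: computes_parity_def prob_out_eq_prob_on run_eq_run_on)

lemma computes_parity_error_nonneg:
  "computes_parity n a d C eps \<Longrightarrow> 0 \<le> eps"
  using prob_on_nonneg order_trans unfolding computes_parity_iff by blast

lemma computes_parity_error_mono:
  "computes_parity n a d C eps \<Longrightarrow> eps \<le> eps' \<Longrightarrow> computes_parity n a d C eps'"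
  unfolding computes_parity_def by (meson order_trans)

text \<open>A single copy of \<open>C\<close> keeps its own wires, via \<open>parallel\<close> with
  \<open>F = snd\<close>. The additional wires get identity gates, and by
  \<open>prob_on_parallel_block\<close> the outcome is unaffected.\<close>

lemma computes_parity_pad_ancillas:
  assumes C: "computes_parity n a d C eps" and a: "a \<le> a'" and n: "0 < n"
  shows "\<exists>C'. computes_parity n a' d C' eps"
proof -
  let ?C = "parallel snd 1 (n + a) C"
  have F: "inj_on snd ({..<1::nat} \<times> {..<n + a})" "snd ` ({..<1::nat} \<times> {..<n + a}) \<subseteq> {..<n + a'}"
    using a by (auto simp: inj_on_def)
  have C': "qac0_circuit (n + a) d C" using C by (simp add: computes_parity_iff)
  have "prob_on {..<n + a'} 0 (\<not> parity n x) (run_on {..<n + a'} ?C d (input_state n x)) \<le> eps" for x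
  proof -
    let ?z = "\<lambda>i. i < n \<and> x i"
    have "pull (\<lambda>i. snd (0::nat, i)) (n + a) ?z = ?z" by (auto simp: pull_def)
    then have "prob_on {..<n + a'} (snd (0::nat, 0)) (\<not> parity n x) (run_on {..<n + a'} ?C d (input_state n x))
      = prob_on {..<n + a} 0 (\<not> parity n x) (run_on {..<n + a} C d (input_state n x))
        * norm2_on {..<n + a'} (input_state n x)"
      unfolding input_state_def using n
      by (intro prob_on_parallel_block[OF F C']) (auto simp: input_in_basis_on split: if_splits)
    then show ?thesis
      using C by (simp add: input_state_def indicator_norm2_on input_in_basis_on computes_parity_iff)
  qed
  then show ?thesis
    using qac0_circuit_parallel[OF F C'] unfolding computes_parity_iff by blast
qed

section \<open>Parity of blocks and numbering of wires\<close>

lemma parity_iff_odd_sum: "parity n x \<longleftrightarrow> odd (\<Sum>i<n. of_bool (x i) :: nat)"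
proof -
  have "(\<Sum>i<n. of_bool (x i) :: nat) = card {i. i < n \<and> x i}"
    by (simp add: Int_def)
  then show ?thesis by (simp add: parity_def)
qed

text \<open>Parity is a sum modulo 2, so each block may be replaced by its own parity before
  summing.\<close>

lemma parity_blocks: "parity (n * b) x = parity n (\<lambda>k. parity b (\<lambda>i. x (k * b + i)))"
proof -
  have "(\<Sum>i\<in>{k * b..<k * b + b}. of_bool (x i)) = (\<Sum>i<b. of_bool (x (k * b + i)) :: nat)" for k
    using sum.shift_bounds_nat_ivl[of "\<lambda>i. of_bool (x i) :: nat" 0 "k * b" b]
    by (simp add: add.commute atLeast0LessThan)
  then have "(\<Sum>i<n * b. of_bool (x i) :: nat) = (\<Sum>k<n. \<Sum>i<b. of_bool (x (k * b + i)))"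
    by (simp add: sum.nat_group[symmetric])
  moreover have "odd (\<Sum>k<n. f k) \<longleftrightarrow> odd (\<Sum>k<n. of_bool (odd (f k)) :: nat)" for f :: "nat \<Rightarrow> nat"
    by (induction n) auto
  ultimately show ?thesis by (simp add: parity_iff_odd_sum)
qed

lemma mult_add_inj:
  fixes k k' i i' b :: nat
  assumes "i < b" "i' < b" "k * b + i = k' * b + i'"
  shows "k = k' \<and> i = i'"
proof -
  have "(k * b + i) div b = k" if "i < b" for k i using that by simp
  then have "k = k'" using assms by metis
  then show ?thesis using assms(3) by simp
qed

lemma mult_add_less:
  fixes k i b n :: nat
  assumes "k < n" "i < b"
  shows "k * b + i < n * b"
proof -
  have "k * b + i < Suc k * b" using assms by simp
  also have "\<dots> \<le> n * b" using assms by (intro mult_le_mono1) simp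
  finally show ?thesis .
qed

text \<open>One level of the tree: \<open>n\<close> copies of \<open>C1\<close> act on blocks of
  \<open>b\<close> bits, then \<open>C2\<close> acts on their outputs, with fresh ancillas and
  without cleaning the garbage. The error is a union bound over the blocks plus the error of
  \<open>C2\<close>, doubled by \<open>prob_on_add_le\<close>.\<close>

lemma computes_parity_compose:
  assumes C1: "computes_parity b a1 d1 C1 e1" and C2: "computes_parity n a2 d2 C2 e2"
    and b: "0 < b" and n: "0 < n"
  shows "\<exists>C. computes_parity (n * b) (a2 + n * a1) (d1 + d2) C (2 * e2 + 2 * (real n * e1))"
proof -
  define N where "N = n * b + (a2 + n * a1)"
  \<comment> \<open>Wires are laid out as \<open>n\<close> blocks of \<open>b\<close> input bits,
    then the \<open>a2\<close> ancillas of \<open>C2\<close>, then \<open>n\<close> groups of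
    \<open>a1\<close> ancillas for the copies of \<open>C1\<close>.\<close>
  define F1 where "F1 = (\<lambda>(k, i). if i < b then k * b + i else n * b + a2 + (k * a1 + (i - b)))"
  \<comment> \<open>Input \<open>i\<close> of \<open>C2\<close> is wire \<open>i * b\<close>, the
    first wire of block \<open>i\<close>, where the copy of \<open>C1\<close> leaves its output.
    Wire 0 is thus also the final output.\<close>
  define F2 where "F2 = (\<lambda>(k::nat, i). if i < n then i * b else n * b + (i - n))"
  define P1 where "P1 = parallel F1 n (b + a1) C1"
  define P2 where "P2 = parallel F2 1 (n + a2) C2"
  have Q1: "qac0_circuit (b + a1) d1 C1" and Q2: "qac0_circuit (n + a2) d2 C2"
    using C1 C2 by (auto simp: computes_parity_iff)
  have F1_cases: "i < b \<and> F1 (k, i) = k * b + i \<and> F1 (k, i) < n * b \<or>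
      b \<le> i \<and> i - b < a1 \<and> F1 (k, i) = n * b + a2 + (k * a1 + (i - b)) \<and> F1 (k, i) < N"
    if "k < n" "i < b + a1" for k i
  proof (cases "i < b")
    case True
    then show ?thesis using mult_add_less[OF that(1) True] by (simp add: F1_def)
  next
    case False
    then have "i - b < a1" using that(2) by simp
    then show ?thesis
      using False mult_add_less[OF that(1), of "i - b" a1] by (simp add: F1_def N_def)
  qed
  have inj1: "inj_on F1 ({..<n} \<times> {..<b + a1})"
  proof (rule inj_onI, clarsimp)
    fix k i k' i' assume *: "k < n" "i < b + a1" "k' < n" "i' < b + a1" "F1 (k, i) = F1 (k', i')"
    show "k = k' \<and> i = i'"
    proof (cases "i < b")
      case True
      then show ?thesis
        using * F1_cases[of k i] F1_cases[of k' i'] mult_add_inj[of i b i' k k'] by linarith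
    next
      case False
      then have "b \<le> i'" "k * a1 + (i - b) = k' * a1 + (i' - b)" "i - b < a1" "i' - b < a1"
        using * F1_cases[of k i] F1_cases[of k' i'] by linarith+
      then show ?thesis
        using False mult_add_inj[of "i - b" a1 "i' - b" k k'] by linarith
    qed
  qed
  have F1: "F1 ` ({..<n} \<times> {..<b + a1}) \<subseteq> {..<N}"
  proof clarsimp
    fix k i assume "k < n" "i < b + a1"
    then show "F1 (k, i) < N" using F1_cases[of k i] by (auto simp: N_def)
  qed
  have inj2: "inj_on F2 ({..<1} \<times> {..<n + a2})"
  proof (rule inj_onI, clarsimp)
    have F2_cases: "i < n \<and> F2 (0, i) = i * b \<and> F2 (0, i) < n * b \<or> n \<le> i \<and> F2 (0, i) = n * b + (i - n)" for i
      using b by (auto simp: F2_def)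
    fix i i' assume *: "F2 (0, i) = F2 (0, i')"
    then have "i * b = i' * b \<or> n \<le> i \<and> n \<le> i' \<and> i - n = i' - n"
      using F2_cases[of i] F2_cases[of i'] by linarith
    then show "i = i'" using b by auto
  qed
  have F2: "F2 ` ({..<1} \<times> {..<n + a2}) \<subseteq> {..<N}"
  proof clarsimp
    fix i assume "i < n + a2"
    moreover have "i * b < N" if "i < n" unfolding N_def using mult_add_less[OF that b] by linarith
    ultimately show "F2 (0, i) < N" by (auto simp: F2_def N_def)
  qed
  have P1: "qac0_circuit N d1 P1" and P2: "qac0_circuit N d2 P2"
    unfolding P1_def P2_def using inj1 F1 Q1 inj2 F2 Q2 by (auto intro: qac0_circuit_parallel)
  have e1: "0 \<le> e1" and e2: "0 \<le> e2"
    using C1 C2 computes_parity_error_nonneg by auto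
  have "prob_on {..<N} 0 (\<not> parity (n * b) x)
      (run_on {..<N} (sequential d1 P1 P2) (d1 + d2) (input_state (n * b) x)) \<le> 2 * e2 + 2 * (real n * e1)" for x
  proof -
    let ?z = "\<lambda>i. i < n * b \<and> x i"
    define p where "p = (\<lambda>k. parity b (\<lambda>i. x (k * b + i)))"
    \<comment> \<open>\<open>t\<close> is the ideal input of \<open>C2\<close>: the true block
      parities followed by ancillas in state zero.\<close>
    define t where "t = (\<lambda>i. i < n \<and> p i)"
    define h where "h = (\<lambda>i. F2 (0, i))"
    define \<Psi> where "\<Psi> = run_on {..<N} P1 d1 (input_state (n * b) x)"
    \<comment> \<open>The state is projected onto the strings that show \<open>t\<close> on the
      wires of \<open>C2\<close> and onto the others; garbage on the remaining wires is left
      arbitrary.\<close>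
    define \<Psi>1 where "\<Psi>1 = (\<lambda>r. if pull h (n + a2) r = t then \<Psi> r else 0)"
    define \<Psi>2 where "\<Psi>2 = (\<lambda>r. if pull h (n + a2) r = t then 0 else \<Psi> r)"
    have z: "?z \<in> basis_on {..<N}" by (rule input_in_basis_on) (simp add: N_def)
    have norm_in: "norm2_on {..<N} (input_state (n * b) x) = 1"
      unfolding input_state_def by (rule indicator_norm2_on[OF _ z]) simp
    have norm_\<Psi>: "norm2_on {..<N} \<Psi> = 1"
      using P1 unfolding \<Psi>_def
      by (subst norm2_on_run_on) (auto simp: norm_in qac0_circuit_def)
    have out: "prob_on {..<N} (k * b) (\<not> p k) \<Psi> \<le> e1" if k: "k < n" for k
    proof -
      let ?t = "\<lambda>i. i < b \<and> x (k * b + i)"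
      have t: "?t \<in> basis_on {..<b + a1}" by (rule input_in_basis_on) simp
      have supp: "pull (\<lambda>i. F1 (k, i)) (b + a1) r = ?t" if "input_state (n * b) x r \<noteq> 0" for r
      proof -
        have r: "r = ?z" using that unfolding input_state_def by presburger
        have "(F1 (k, i) < n * b \<and> x (F1 (k, i))) = (i < b \<and> x (k * b + i))" if "i < b + a1" for i
        proof -
          have "i < b \<and> F1 (k, i) = k * b + i \<and> F1 (k, i) < n * b \<or> b \<le> i \<and> \<not> F1 (k, i) < n * b"
            using F1_cases[OF k that] by linarith
          then show ?thesis by auto
        qed
        then show ?thesis
          unfolding pull_def r by (intro ext) (metis trans_less_add1)
      qed
      have "prob_on {..<N} (F1 (k, 0)) (\<not> p k) \<Psi>
          = prob_on {..<b + a1} 0 (\<not> p k) (run_on {..<b + a1} C1 d1 (\<lambda>r. if r = ?t then 1 else 0))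
            * norm2_on {..<N} (input_state (n * b) x)"
        unfolding \<Psi>_def P1_def using b
        by (intro prob_on_parallel_block[OF inj1 F1 Q1 k _ t] supp) auto
      also have "\<dots> \<le> e1"
        using C1 norm_in unfolding computes_parity_iff p_def input_state_def by simp
      finally show ?thesis using b by (simp add: F1_def)
    qed
    \<comment> \<open>The copies of \<open>C1\<close> never touch the ancillas of \<open>C2\<close>,
      which therefore add nothing to the union bound.\<close>
    have idle: "prob_on {..<N} (n * b + i) True \<Psi> = 0" if i: "i < a2" for i
    proof -
      have "n * b + i \<notin> F1 ` ({..<n} \<times> {..<b + a1})"
      proof clarsimp
        fix k j assume "k < n" "j < b + a1" "n * b + i = F1 (k, j)"
        then show False using F1_cases[of k j] i by auto
      qed
      then have "fst P1 j (n * b + i) = gate_id" for j by (simp add: P1_def parallel_def)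
      then have "\<Psi> r = 0" if "r \<in> basis_on {..<N}" "r (n * b + i)" for r
        unfolding \<Psi>_def using that i
        by (intro run_on_idle_wire[where q = "n * b + i" and v = False])
           (auto simp: N_def input_state_def)
      then show ?thesis unfolding prob_on_def by (intro sum.neutral) auto
    qed
    have norm2: "norm2_on {..<N} \<Psi>2 \<le> real n * e1"
    proof -
      \<comment> \<open>A string in the bad part disagrees with \<open>t\<close> on at least one
        wire of \<open>C2\<close>, so its weight is counted at least once on the right.\<close>
      have "(cmod (\<Psi>2 r))\<^sup>2 \<le> (\<Sum>i<n + a2. if r (h i) = (\<not> t i) then (cmod (\<Psi> r))\<^sup>2 else 0)" for r
      proof (cases "pull h (n + a2) r = t")
        case False
        then obtain i where ne: "pull h (n + a2) r i \<noteq> t i" by blast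
        then have i: "i < n + a2"
          unfolding pull_def t_def by (meson trans_less_add1)
        moreover have "r (h i) = (\<not> t i)" using ne i by (simp add: pull_def)
        ultimately show ?thesis
          using False member_le_sum[of i "{..<n + a2}" "\<lambda>i. if r (h i) = (\<not> t i) then (cmod (\<Psi> r))\<^sup>2 else 0"]
          by (simp add: \<Psi>2_def)
      qed (simp add: \<Psi>2_def sum_nonneg)
      then have "norm2_on {..<N} \<Psi>2
          \<le> (\<Sum>r\<in>basis_on {..<N}. \<Sum>i<n + a2. if r (h i) = (\<not> t i) then (cmod (\<Psi> r))\<^sup>2 else 0)"
        unfolding norm2_on_def by (intro sum_mono)
      also have "\<dots> = (\<Sum>i<n + a2. prob_on {..<N} (h i) (\<not> t i) \<Psi>)"
        unfolding prob_on_def by (rule sum.swap)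
      also have "\<dots> \<le> (\<Sum>i<n + a2. if i < n then e1 else 0)"
      proof (rule sum_mono)
        fix i assume "i \<in> {..<n + a2}"
        then show "prob_on {..<N} (h i) (\<not> t i) \<Psi> \<le> (if i < n then e1 else 0)"
          using out[of i] idle[of "i - n"] by (auto simp: h_def F2_def t_def)
      qed
      also have "\<dots> = (\<Sum>i\<in>{..<n + a2} \<inter> {i. i < n}. e1)"
        by (subst sum.inter_restrict) auto
      also have "{..<n + a2} \<inter> {i. i < n} = {..<n}" by auto
      finally show ?thesis by simp
    qed
    \<comment> \<open>On the good part \<open>C2\<close> sees exactly \<open>t\<close>; the garbage
      contributes only the squared norm, which is at most 1 after projection.\<close>
    have "prob_on {..<N} 0 (\<not> parity (n * b) x) (run_on {..<N} P2 d2 \<Psi>1) \<le> e2"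
    proof -
      have t: "t \<in> basis_on {..<n + a2}" unfolding t_def by (rule input_in_basis_on) simp
      have "prob_on {..<N} (F2 (0, 0)) (\<not> parity n p) (run_on {..<N} P2 d2 \<Psi>1)
        = prob_on {..<n + a2} 0 (\<not> parity n p) (run_on {..<n + a2} C2 d2 (\<lambda>r. if r = t then 1 else 0))
          * norm2_on {..<N} \<Psi>1"
        unfolding P2_def using n
        by (intro prob_on_parallel_block[OF inj2 F2 Q2 _ _ t])
           (auto simp: \<Psi>1_def h_def split: if_splits)
      also have "\<dots> \<le> e2 * 1"
      proof (rule mult_mono)
        show "prob_on {..<n + a2} 0 (\<not> parity n p)
            (run_on {..<n + a2} C2 d2 (\<lambda>r. if r = t then 1 else 0)) \<le> e2"
          using C2 unfolding computes_parity_iff input_state_def t_def by blast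
        have "norm2_on {..<N} \<Psi>1 \<le> norm2_on {..<N} \<Psi>"
          unfolding norm2_on_def \<Psi>1_def by (intro sum_mono) simp
        then show "norm2_on {..<N} \<Psi>1 \<le> 1" by (simp add: norm_\<Psi>)
      qed (use e2 norm2_on_nonneg in auto)
      finally show ?thesis using n by (simp add: F2_def parity_blocks p_def)
    qed
    \<comment> \<open>Nothing is assumed about the output on the bad part: its whole squared norm
      counts as error.\<close>
    moreover have "prob_on {..<N} 0 (\<not> parity (n * b) x) (run_on {..<N} P2 d2 \<Psi>2) \<le> real n * e1"
    proof -
      have "norm2_on {..<N} (run_on {..<N} P2 d2 \<Psi>2) = norm2_on {..<N} \<Psi>2"
        using P2 by (intro norm2_on_run_on) (auto simp: qac0_circuit_def)
      then show ?thesis using prob_on_le_norm2_on norm2 by (metis order_trans)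
    qed
    moreover have "\<Psi> = (\<lambda>r. \<Psi>1 r + \<Psi>2 r)" by (auto simp: \<Psi>1_def \<Psi>2_def)
    then have "run_on {..<N} (sequential d1 P1 P2) (d1 + d2) (input_state (n * b) x)
        = (\<lambda>r. run_on {..<N} P2 d2 \<Psi>1 r + run_on {..<N} P2 d2 \<Psi>2 r)"
      using run_on_add[of "{..<N}" P2 d2 \<Psi>1 \<Psi>2] by (simp add: run_on_sequential \<Psi>_def)
    ultimately show ?thesis
      using prob_on_add_le[of "{..<N}" 0 "\<not> parity (n * b) x" "run_on {..<N} P2 d2 \<Psi>1" "run_on {..<N} P2 d2 \<Psi>2"]
      by simp
  qed
  then show ?thesis
    using qac0_circuit_sequential[OF P1 P2] unfolding computes_parity_iff N_def by blast
qed

text \<open>The root of the tree before any level is attached: a single bit is its own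
  parity.\<close>

lemma computes_parity_one: "\<exists>C. computes_parity 1 0 0 C 0"
proof
  let ?C = "(\<lambda>_ _. gate_id, \<lambda>_. {}) :: circuit"
  show "computes_parity 1 0 0 ?C 0"
    unfolding computes_parity_iff
  proof (intro conjI allI)
    show "qac0_circuit (1 + 0) 0 ?C" by (simp add: qac0_circuit_def unitary1_gate_id)
    fix x :: "nat \<Rightarrow> bool"
    have "{i. i < 1 \<and> x i} = (if x 0 then {0} else {})" by auto
    then have "parity 1 x = x 0" by (simp add: parity_def)
    then have "run_on {..<1 + 0} ?C 0 (input_state 1 x) r = 0"
      if "r \<in> basis_on {..<1 + 0}" "r 0 = (\<not> parity 1 x)" for r
      using that by (intro run_on_idle_wire[where q = 0 and v = "x 0"]) (auto simp: input_state_def)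
    then show "prob_on {..<1 + 0} 0 (\<not> parity 1 x) (run_on {..<1 + 0} ?C 0 (input_state 1 x)) \<le> 0"
      unfolding prob_on_def by (intro sum_nonpos) simp
  qed
qed

text \<open>The levels are listed from the root: \<open>K\<close> stages of \<open>2 c\<close> levels, the fan-in of stage
  \<open>i\<close> being \<open>t ^ 2 ^ (K - i - 1)\<close>. Since fewer blocks remain near the root, they can afford a larger
  fan-in, and each level uses at most \<open>t ^ (2 * c * 2 ^ K - c - 1)\<close> ancillas.\<close>

lemma parity_tree:
  fixes t c d K :: nat
  assumes H: "\<And>n. n \<ge> N0 \<Longrightarrow> computes_parity n (n ^ c) d (U n) (eps n)"
    and t: "N0 \<le> t" "0 < t" and c: "0 < c"
    and M: "\<And>e. e \<in> {1..2 ^ K} \<Longrightarrow> eps (t ^ e) \<le> M"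
  defines "E \<equiv> 2 * c * (2 ^ K - 1)"
  shows "\<exists>C. computes_parity (t ^ E) (2 * c * K * t ^ (E + c - 1)) (2 * c * K * d) C
    (4 ^ (2 * c * K) * real t ^ E * M)"
proof -
  \<comment> \<open>\<open>Inv s l\<close> stands for a tree of \<open>l\<close> levels with
    \<open>t ^ s\<close> leaves. The error bound already uses the final exponent \<open>E\<close>,
    and every level is granted the same ancilla budget.\<close>
  define Inv where "Inv = (\<lambda>s l. \<exists>C. computes_parity (t ^ s) (l * t ^ (E + c - 1)) (l * d) C
    (4 ^ l * real t ^ E * M))"
  have te: "N0 \<le> t ^ e" if "1 \<le> e" for e
    using t that power_increasing[of 1 e t] by simp
  have M0: "0 \<le> M"
    using M[of 1] computes_parity_error_nonneg[OF H[OF te[of 1]]] by simp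
  \<comment> \<open>A new level is attached at the leaves: \<open>t ^ s\<close> blocks of
    \<open>t ^ e\<close> bits need \<open>t ^ (s + c * e)\<close> ancillas, and the union bound
    costs a factor \<open>t ^ s\<close>. The two inequalities on \<open>s\<close> keep these within
    budget.\<close>
  have step: "Inv (s + e) (Suc l)"
    if s: "Inv s l" and e: "e \<in> {1..2 ^ K}" "s + c * e \<le> E + c - 1" "s \<le> E" for s e l
  proof -
    obtain C where C: "computes_parity (t ^ s) (l * t ^ (E + c - 1)) (l * d) C (4 ^ l * real t ^ E * M)"
      using s unfolding Inv_def by blast
    have B: "computes_parity (t ^ e) ((t ^ e) ^ c) d (U (t ^ e)) (eps (t ^ e))"
      using e(1) by (intro H te) simp
    obtain C' where "computes_parity (t ^ s * t ^ e) (l * t ^ (E + c - 1) + t ^ s * (t ^ e) ^ c) (d + l * d) C'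
        (2 * (4 ^ l * real t ^ E * M) + 2 * (real (t ^ s) * eps (t ^ e)))"
      using computes_parity_compose[OF B C] t by auto
    moreover have "l * t ^ (E + c - 1) + t ^ s * (t ^ e) ^ c \<le> Suc l * t ^ (E + c - 1)"
    proof -
      have "t ^ s * (t ^ e) ^ c = t ^ (s + c * e)"
        by (simp add: power_add power_mult[symmetric] mult.commute)
      also have "\<dots> \<le> t ^ (E + c - 1)" using t e(2) by (intro power_increasing) auto
      finally show ?thesis by simp
    qed
    \<comment> \<open>Both summands are at most \<open>2 * 4 ^ l\<close> times the common quantity,
      whence the base 4.\<close>
    moreover have "2 * (4 ^ l * real t ^ E * M) + 2 * (real (t ^ s) * eps (t ^ e))
        \<le> 4 ^ Suc l * real t ^ E * M"
    proof -
      have "real (t ^ s) * eps (t ^ e) \<le> real t ^ E * M"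
        unfolding of_nat_power
        using t e(3) M[OF e(1)] computes_parity_error_nonneg[OF B]
        by (intro mult_mono power_increasing) auto
      also have "\<dots> \<le> 4 ^ l * (real t ^ E * M)"
        using mult_right_mono[of 1 "4 ^ l" "real t ^ E * M"] M0 by simp
      finally show ?thesis by (simp add: mult_ac)
    qed
    ultimately have "\<exists>C. computes_parity (t ^ s * t ^ e) (Suc l * t ^ (E + c - 1)) (d + l * d) C
        (4 ^ Suc l * real t ^ E * M)"
      using t by (intro computes_parity_pad_ancillas[OF computes_parity_error_mono]) auto
    then show ?thesis by (simp add: Inv_def power_add)
  qed
  \<comment> \<open>The fan-in exponents of the first \<open>i\<close> stages form a geometric sum,
    \<open>2 * c\<close> times \<open>2 ^ (K - 1) + ... + 2 ^ (K - i)\<close>.\<close>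
  have stage: "Inv (2 * c * (2 ^ K - 2 ^ (K - i))) (2 * c * i)" if "i \<le> K" for i
    using that
  proof (induction i)
    case 0
    have "\<exists>C. computes_parity 1 0 0 C (real t ^ E * M)"
      using computes_parity_one computes_parity_error_mono M0
      by (metis mult_nonneg_nonneg of_nat_0_le_iff zero_le_power)
    then show ?case by (simp add: Inv_def)
  next
    case (Suc i)
    define e :: nat where "e = 2 ^ (K - Suc i)"
    define s where "s = 2 * c * (2 ^ K - 2 ^ (K - i))"
    have e2: "2 ^ (K - i) = 2 * e"
      using Suc.prems by (simp add: e_def Suc_diff_Suc flip: power_Suc)
    have eK: "2 * e \<le> 2 ^ K" unfolding e2[symmetric] by (rule power_increasing) auto
    have e1: "1 \<le> e" by (simp add: e_def)
    obtain w where w: "2 ^ K = 2 * e + w" using eK le_Suc_ex by blast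
    have s: "s = 2 * c * w" by (simp add: s_def e2 w)
    \<comment> \<open>Written additively to avoid truncated subtraction.\<close>
    have E: "E + 2 * c = s + 4 * (c * e)"
    proof -
      have "E + 2 * c = 2 * c * (2 ^ K - 1 + 1)" unfolding E_def add_mult_distrib2 by simp
      then show ?thesis unfolding w s using e1 by (simp add: algebra_simps)
    qed
    have ce: "c \<le> c * e" using e1 by simp
    have "Inv (s + r * e) (2 * c * i + r)" if "r \<le> 2 * c" for r
      using that
    proof (induction r)
      case 0
      then show ?case using Suc by (simp add: s_def)
    next
      case (Suc r)
      have re: "r * e + e \<le> 2 * (c * e)" using mult_le_mono1[OF Suc.prems, of e] by simp
      have "Inv (s + r * e + e) (Suc (2 * c * i + r))"
      proof (rule step)
        show "Inv (s + r * e) (2 * c * i + r)" using Suc by simp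
        show "e \<in> {1..2 ^ K}" using e1 eK by simp
        \<comment> \<open>At most \<open>2 * c - 1\<close> levels precede within the stage, so the
          left side is at most \<open>s + 3 * (c * e) - e\<close>, that is
          \<open>E + 2 * c - c * e - e\<close>; now \<open>c \<le> c * e\<close> and
          \<open>1 \<le> e\<close> apply.\<close>
        show "s + r * e + c * e \<le> E + c - 1"
          using E re e1 ce by linarith
        show "s + r * e \<le> E"
          using E re e1 ce by linarith
      qed
      then show ?case by (simp add: add_ac)
    qed
    from this[of "2 * c"] have "Inv (s + 2 * c * e) (2 * c * i + 2 * c)" by simp
    moreover have "s + 2 * c * e = 2 * c * (2 ^ K - 2 ^ (K - Suc i))"
      unfolding e_def[symmetric] s w by (simp add: algebra_simps)
    ultimately show ?case by (simp add: algebra_simps)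
  qed
  from stage[of K] show ?thesis by (simp add: Inv_def E_def)
qed

section \<open>Asymptotics of the error and the ancilla count\<close>

lemma negligible_sum_powers:
  fixes E c' Q :: nat
  assumes eps: "negligible eps" and A: "0 \<le> A"
  shows "\<forall>\<^sub>F t in sequentially.
    A * real t ^ E * (\<Sum>e=1..Q. eps (t ^ e)) < inverse (real (t ^ E) ^ c')"
proof -
  \<comment> \<open>\<open>E\<close> cancels the prefactor \<open>t ^ E\<close>,
    \<open>E * c'\<close> yields the required decay, and the extra 1 gives a factor \<open>t\<close>
    that absorbs the constant \<open>A * Q\<close>.\<close>
  define k where "k = E + E * c' + 1"
  have "\<forall>\<^sub>F n in sequentially. eps n < inverse (real n ^ k)"
    using eps by (simp add: negligible_def)
  then obtain n1 where n1: "\<And>n. n \<ge> n1 \<Longrightarrow> eps n < inverse (real n ^ k)"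
    by (auto simp: eventually_at_top_linorder)
  have bound: "A * real t ^ E * (\<Sum>e=1..Q. eps (t ^ e)) < inverse (real (t ^ E) ^ c')"
    if t: "t \<ge> n1" "1 \<le> t" and At: "A * real Q < real t" for t
  proof -
    have "eps (t ^ e) \<le> inverse (real t ^ k)" if "e \<in> {1..Q}" for e
    proof -
      have te: "t \<le> t ^ e" using that t power_increasing[of 1 e t] by simp
      have "eps (t ^ e) < inverse (real (t ^ e) ^ k)" using te t by (intro n1) simp
      also have "\<dots> \<le> inverse (real t ^ k)"
        using te t by (intro le_imp_inverse_le power_mono) (simp_all flip: of_nat_power)
      finally show ?thesis by simp
    qed
    then have "(\<Sum>e=1..Q. eps (t ^ e)) \<le> (\<Sum>e=1..Q. inverse (real t ^ k))"
      by (rule sum_mono)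
    then have "A * real t ^ E * (\<Sum>e=1..Q. eps (t ^ e)) \<le> A * real t ^ E * (real Q * inverse (real t ^ k))"
      using A by (intro mult_left_mono) auto
    also have "\<dots> = (A * real Q) * (real t ^ E * inverse (real t ^ k))" by simp
    also have "\<dots> < real t * (real t ^ E * inverse (real t ^ k))"
      using At t by (intro mult_strict_right_mono) auto
    also have "\<dots> = inverse (real (t ^ E) ^ c')"
      using t by (simp add: k_def power_add power_mult field_simps)
    finally show ?thesis .
  qed
  have "\<forall>\<^sub>F t in sequentially. t \<ge> n1" "\<forall>\<^sub>F t in sequentially. 1 \<le> t"
    by (auto intro: eventually_ge_at_top)
  moreover have "\<forall>\<^sub>F t in sequentially. A * real Q < real t"
    using filterlim_real_sequentially by (auto simp: filterlim_at_top_dense)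
  ultimately show ?thesis by eventually_elim (rule bound)
qed

text \<open>The error is known only at \<open>n = t ^ E\<close>; elsewhere the default 0 makes the
  bound trivial. As \<open>E > 0\<close>, \<open>t\<close> is determined by \<open>n\<close> and
  grows with it.\<close>

lemma negligible_along_powers:
  fixes E :: nat
  assumes E: "0 < E" and g: "\<And>c'::nat. \<forall>\<^sub>F t in sequentially. g t < inverse (real (t ^ E) ^ c')"
  shows "negligible (\<lambda>n. if n \<in> range (\<lambda>t::nat. t ^ E) then g (inv (\<lambda>t. t ^ E) n) else 0)"
  unfolding negligible_def
proof
  fix c' :: nat
  have inj: "inj (\<lambda>t::nat. t ^ E)"
    using E by (intro injI) (auto dest: power_eq_imp_eq_base)
  obtain t1 where t1: "\<And>t. t \<ge> t1 \<Longrightarrow> g t < inverse (real (t ^ E) ^ c')"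
    using g[of c'] by (auto simp: eventually_at_top_linorder)
  have bound: "(if n \<in> range (\<lambda>t::nat. t ^ E) then g (inv (\<lambda>t. t ^ E) n) else 0) < inverse (real n ^ c')"
    if n: "n \<ge> t1 ^ E" "0 < n" for n
  proof (cases "n \<in> range (\<lambda>t::nat. t ^ E)")
    case True
    then obtain t where t: "n = t ^ E" by auto
    then have "t1 \<le> t" using n E power_mono_iff[of t1 t E] by simp
    then show ?thesis using t1[of t] by (simp add: t inv_f_f[OF inj])
  qed (use n in auto)
  have "\<forall>\<^sub>F n in sequentially. n \<ge> t1 ^ E" "\<forall>\<^sub>F n in sequentially. 0 < n"
    by (auto intro: eventually_ge_at_top eventually_gt_at_top)
  then show "\<forall>\<^sub>F n in sequentially.
      (if n \<in> range (\<lambda>t::nat. t ^ E) then g (inv (\<lambda>t. t ^ E) n) else 0) < inverse (real n ^ c')"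
    by eventually_elim (rule bound)
qed

text \<open>With this \<open>E\<close>, the product
  \<open>E * 2 powr (- K) = 2 * c * (1 - 2 powr (- K))\<close> is at least \<open>c\<close> as soon
  as \<open>K \<ge> 1\<close>, so \<open>E + c \<le> E * (1 + 2 powr (- K))\<close>. One spare power
  of \<open>t\<close> absorbs the number \<open>2 * c * K\<close> of levels.\<close>

lemma ancilla_budget:
  fixes t c K :: nat
  assumes K: "1 \<le> K" and t: "2 * c * K \<le> t" "0 < t" and c: "0 < c"
  defines "E \<equiv> 2 * c * (2 ^ K - 1)"
  shows "2 * c * K * t ^ (E + c - 1) \<le> nat \<lfloor>real (t ^ E) powr (1 + 2 powr (- real K))\<rfloor>"
proof -
  have "2 * c * K * t ^ (E + c - 1) \<le> t * t ^ (E + c - 1)"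
    using t by (intro mult_le_mono1)
  also have "\<dots> = t ^ (E + c)" using c by (simp flip: power_Suc)
  finally have le: "2 * c * K * t ^ (E + c - 1) \<le> t ^ (E + c)" .
  have half: "2 powr (- real K) \<le> 1 / 2"
    using powr_mono[of "- real K" "- 1" 2] K by (simp add: powr_minus_divide)
  have "real E = 2 * real c * (2 ^ K - 1)"
    unfolding E_def by (simp add: of_nat_diff)
  moreover have "2 ^ K * 2 powr (- real K) = (1::real)"
    by (simp add: powr_minus powr_realpow)
  ultimately have "real E * 2 powr (- real K) = 2 * real c * (1 - 2 powr (- real K))"
    by (simp add: left_diff_distrib)
  also have "\<dots> \<ge> 2 * real c * (1 / 2)" using half by (intro mult_left_mono) auto
  finally have Ec: "real E + real c \<le> real E * (1 + 2 powr (- real K))"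
    by (simp add: algebra_simps)
  have "real (t ^ (E + c)) = real t powr (real E + real c)"
    using t by (simp flip: powr_realpow)
  also have "\<dots> \<le> real t powr (real E * (1 + 2 powr (- real K)))"
    using Ec t by (intro powr_mono) auto
  also have "\<dots> = real (t ^ E) powr (1 + 2 powr (- real K))"
    using t by (simp add: powr_powr flip: powr_realpow)
  finally have "int (t ^ (E + c)) \<le> \<lfloor>real (t ^ E) powr (1 + 2 powr (- real K))\<rfloor>"
    by (simp add: le_floor_iff)
  then show ?thesis using le by linarith
qed

theorem theorem5p2:
  shows "\<exists>C0::nat. \<forall>(d::nat) (c::nat) (N0::nat) (U::nat \<Rightarrow> circuit) (eps::nat \<Rightarrow> real).
    (0 < d \<and> 0 < c \<and> 0 < N0 \<and> negligible eps \<and>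
     (\<forall>n\<ge>N0. computes_parity n (n ^ c) d (U n) (eps n))) \<longrightarrow>
    (\<exists>D::nat. D \<le> C0 * c * d \<and>
      (\<forall>K::nat. 1 \<le> K \<longrightarrow>
        (\<exists>(S::nat set) (V::nat \<Rightarrow> circuit) (delta::nat \<Rightarrow> real).
           infinite S \<and> negligible delta \<and>
           (\<forall>n\<in>S. computes_parity n (nat \<lfloor>real n powr (1 + 2 powr (- real K))\<rfloor>)
                      (K * D) (V n) (delta n)))))"
proof (rule exI[of _ 2], intro allI impI, elim conjE)
  fix d c N0 :: nat and U :: "nat \<Rightarrow> circuit" and eps :: "nat \<Rightarrow> real"
  assume c: "0 < c" and eps: "negligible eps"
    and H: "\<forall>n\<ge>N0. computes_parity n (n ^ c) d (U n) (eps n)"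
  show "\<exists>D\<le>2 * c * d. \<forall>K::nat. 1 \<le> K \<longrightarrow>
        (\<exists>(S::nat set) (V::nat \<Rightarrow> circuit) (delta::nat \<Rightarrow> real).
           infinite S \<and> negligible delta \<and>
           (\<forall>n\<in>S. computes_parity n (nat \<lfloor>real n powr (1 + 2 powr (- real K))\<rfloor>)
                      (K * D) (V n) (delta n)))"
  \<comment> \<open>A tree has \<open>2 * c * K\<close> levels of depth \<open>d\<close>, hence
    \<open>D = 2 * c * d\<close>, the same for every \<open>K\<close>, and the absolute constant
    2.\<close>
  proof (intro exI[of _ "2 * c * d"] conjI allI impI order_refl)
    fix K :: nat assume K: "1 \<le> K"
    define E where "E = 2 * c * (2 ^ K - 1)"
    \<comment> \<open>The sum serves as the bound \<open>M\<close> of \<open>parity_tree\<close>: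
      for the \<open>t\<close> in question the errors are nonnegative, so it dominates each of its
      terms.\<close>
    define g where "g = (\<lambda>t. 4 ^ (2 * c * K) * real t ^ E * (\<Sum>e=1..2 ^ K. eps (t ^ e)))"
    define delta where
      "delta = (\<lambda>n. if n \<in> range (\<lambda>t::nat. t ^ E) then g (inv (\<lambda>t. t ^ E) n) else 0)"
    \<comment> \<open>\<open>t \<ge> N0\<close> makes the given circuits available at every fan-in
      \<open>t ^ e\<close>; \<open>t \<ge> 2 * c * K\<close> is what the ancilla budget asks
      for.\<close>
    define S where "S = (\<lambda>t. t ^ E) ` {max N0 (2 * c * K)..}"
    have "(2::nat) ^ 1 \<le> 2 ^ K" using K by (intro power_increasing) auto
    then have E: "0 < E" using c by (simp add: E_def)
    then have inj: "inj (\<lambda>t::nat. t ^ E)"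
      by (intro injI) (auto dest: power_eq_imp_eq_base)
    have "infinite S"
      unfolding S_def using inj by (simp add: finite_image_iff inj_on_subset infinite_Ici)
    moreover have "negligible delta"
      unfolding delta_def g_def
      by (intro negligible_along_powers[OF E] negligible_sum_powers[OF eps]) simp
    moreover have "\<exists>C. computes_parity n (nat \<lfloor>real n powr (1 + 2 powr (- real K))\<rfloor>)
        (K * (2 * c * d)) C (delta n)" if nS: "n \<in> S" for n
    proof -
      obtain t where t: "n = t ^ E" "N0 \<le> t" "2 * c * K \<le> t" using nS by (auto simp: S_def)
      then have t0: "0 < t" using c K by (cases t) auto
      have "eps (t ^ e) \<le> (\<Sum>e=1..2 ^ K. eps (t ^ e))" if "e \<in> {1..2 ^ K}" for e
      proof (rule member_le_sum[OF that])
        fix e' assume "e' \<in> {1..2 ^ K} - {e}"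
        then have "t \<le> t ^ e'" using t0 power_increasing[of 1 e' t] by simp
        then show "0 \<le> eps (t ^ e')"
          using H t(2) computes_parity_error_nonneg by (meson order_trans)
      qed simp
      then have "\<exists>C. computes_parity (t ^ E) (2 * c * K * t ^ (E + c - 1)) (2 * c * K * d) C (g t)"
        unfolding E_def g_def using H t t0 c by (intro parity_tree[of N0]) auto
      then have "\<exists>C. computes_parity (t ^ E) (nat \<lfloor>real (t ^ E) powr (1 + 2 powr (- real K))\<rfloor>)
          (2 * c * K * d) C (g t)"
        using computes_parity_pad_ancillas ancilla_budget[OF K t(3) t0 c] t0
        unfolding E_def by (meson zero_less_power)
      moreover have "delta n = g t" by (simp add: delta_def t(1) inv_f_f[OF inj])
      ultimately show ?thesis by (simp add: t(1) mult_ac)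
    qed
    ultimately show "\<exists>(S::nat set) (V::nat \<Rightarrow> circuit) (delta::nat \<Rightarrow> real).
           infinite S \<and> negligible delta \<and>
           (\<forall>n\<in>S. computes_parity n (nat \<lfloor>real n powr (1 + 2 powr (- real K))\<rfloor>)
                      (K * (2 * c * d)) (V n) (delta n))"
      by metis
  qed
qed

end
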